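(* Let $1<p<\infty$ and $p'=p/(p-1)$. Let $(X,d,\mu)$ be a complete geodesic metric measure space such that $\mu$ is doubling and the space supports a $(p,p)$-Poincaré inequality, and let $\Omega\subset X$ be a nonempty bounded open connected set with $\mu(X\setminus\Omega)>0$. Fix a Cheeger differentiable structure on $X$ with Cheeger gradient $\nabla$ and pointwise inner products $\langle\cdot,\cdot\rangle_x$ and norms $|\cdot|_x$. Let $f\in L^{p'}(\Omega)$ and $u,g\in N^{1,p}(\Omega)$ be such that $u-g\in N_0^{1,p}(\Omega)$. For $v\in N^{1,p}(\Omega)$ set $$J_C(v):=\int_\Omega|\nabla v|_x^p\,d\mu(x)-p\int_\Omega fv\,d\mu.$$ Then $u$ satisfies $$\int_\Omega|\nabla u|_x^{p-2}\langle\nabla u,\nabla\varphi\rangle_x\,d\mu(x)=\int_\Omega f\varphi\,d\mu\qquad\text{for all }\varphi\in N_0^{1,p}(\Omega)$$ if and only if $J_C(u)\le J_C(v)$ for every $v\in N^{1,p}(\Omega)$ such that $v-g\in N_0^{1,p}(\Omega)$.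
   Context: A metric measure space $(X,d,\mu)$ is a metric space with a Borel regular measure $\mu$; $B(x,r)$ is the open ball, and $u_E=\frac{1}{\mu(E)}\int_E u\,d\mu$ denotes the integral average when $0<\mu(E)<\infty$. The measure is doubling if there is $C_\mu\ge 1$ with $0<\mu(B(x,2r))\le C_\mu\mu(B(x,r))<\infty$ for all $x\in X$, $r>0$. Upper gradients: a Borel function $h:X\to[0,\infty]$ is an upper gradient of $u:X\to\mathbb{R}$ if $|u(\gamma(a))-u(\gamma(b))|\le\int_\gamma h\,ds$ for all nonconstant compact rectifiable curves $\gamma:[a,b]\to X$. It is a $p$-weak upper gradient if this holds for all such curves except a family of $p$-modulus zero, where the $p$-modulus of a curve family $\Gamma$ is $\inf\int_X\rho^p\,d\mu$ over Borel $\rho\ge0$ with $\int_\gamma\rho\,ds\ge1$ for all $\gamma\in\Gamma$. If $u$ has a $p$-weak upper gradient in $L^p(X)$, then there is a unique (up to a.e. equality) one with smallest $L^p$ norm, the minimal $p$-weak upper gradient $g_u$. Newtonian spaces: $u\in N^{1,p}(X)$ if $u\in L^p(X)$ and $u$ has a $p$-weak upper gradient in $L^p(X)$; $\|u\|_{N^{1,p}(X)}=\left(\int_X|u|^p+g_u^p\,d\mu\right)^{1/p}$. The space $N^{1,p}(\Omega)$ is defined in the same way with $\Omega$ (with restricted metric and measure) in place of $X$. $N_0^{1,p}(\Omega)$ consists of the restrictions to $\Omega$ of functions $u\in N^{1,p}(X)$ with $u=0$ in $X\setminus\Omega$ (identified with their zero extensions). Poincaré inequality: $X$ supports a $(p,p)$-Poincaré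 inequality if there are $C_P>0$ and $\lambda\ge1$ such that for every $u\in L^1(X)$, $x\in X$, $r>0$ and every upper gradient $h$ of $u$, $$\left(\frac{1}{\mu(B(x,r))}\int_{B(x,r)}|u-u_{B(x,r)}|^p\,d\mu\right)^{1/p}\le C_P\,r\left(\frac{1}{\mu(B(x,\lambda r))}\int_{B(x,\lambda r)}h^p\,d\mu\right)^{1/p}.$$ Cheeger differentiable structure (known existence theorem for geodesic $X$ as in the claim): A function $u\in N^{1,p}_{\mathrm{loc}}(X)$ is asymptotically generalized linear at $x_0$ if $x_0$ is a Lebesgue point of $g_u^p$ and $\lim_{r\to0}\left(\frac{1}{\mu(B)}\int_{B}g_u^p\,d\mu-\inf_{\varphi}\frac{1}{\mu(B)}\int_{B}g_{u+\varphi}^p\,d\mu\right)=0$, where $B=B(x_0,r)$ and the infimum is over Newtonian functions $\varphi$ with compact support in $B$. There exist a positive integer $N$ and countably many measurable sets $U_\alpha$, which may be taken pairwise disjoint, with $\mu(U_\alpha)>0$ and $\mu(X\setminus\bigcup_\alpha U_\alpha)=0$, and for each $\alpha$ 1-Lipschitz functions $f_1^\alpha,\dots,f_{N(\alpha)}^\alpha$ on $X$, $N(\alpha)\le N$, with $\vec f^\alpha=(f_1^\alpha,\dots,f_{N(\alpha)}^\alpha)$, such that: (1) each $f^\alpha_j$ is asymptotically generalized linear at each point of $U_\alpha$; (2) $g_{\vec a\cdot\vec f^\alpha}(x_0)>0$ for all $\vec a\in\mathbb{R}^{N(\alpha)}\setminus\{0\}$, $x_0\in U_\alpha$; (3) for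 every Lipschitz $u:X\to\mathbb{R}$ there are $V_\alpha(u)\subset U_\alpha$ with $\mu(U_\alpha\setminus V_\alpha(u))=0$ and a Borel map $D^\alpha u:V_\alpha(u)\to\mathbb{R}^{N(\alpha)}$ such that for $x_0\in V_\alpha(u)$, $g_{\vec a\cdot\vec f^\alpha-u}(x_0)=0$ if and only if $\vec a=D^\alpha u(x_0)$. A structure of this kind (not necessarily unique) is fixed. Associated with it there are, for a.e. $x$, an inner product $\langle\cdot,\cdot\rangle_x$ on $\mathbb{R}^N$ with induced norm $|\cdot|_x$, and a bounded linear operator $\nabla:N^{1,p}(X)\to L^p(X:\mathbb{R}^N)$ (the Cheeger gradient) such that $\nabla u=\sum_\alpha D^\alpha u\,\chi_{U_\alpha}$ for Lipschitz $u$ (with $\mathbb{R}^{N(\alpha)}\subset\mathbb{R}^N$), $\nabla(uv)=u\nabla v+v\nabla u$ for Lipschitz $u,v\in N^{1,p}(X)$, and $|\nabla u(x)|_x\le g_u(x)\le\sqrt N\,|\nabla u(x)|_x$ for a.e. $x$. For $u\in N^{1,p}(\Omega)$, $\nabla u$ is defined a.e. in $\Omega$ by locality: $\nabla u=\nabla(\eta u)$ a.e. on $\{\eta=1\}$ for every Lipschitz cutoff $\eta$ with compact support in $\Omega$; it is linear in $u$ and satisfies the same two-sided comparison with $g_u$. *)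

theory Defs
  imports "HOL-Analysis.Analysis"
begin

text \<open>The metric space is a type. A measure \<open>\<mu>\<close> on it is given on a complete sigma-algebra
  containing the Borel sets; together with Borel regularity this is the measure that a Borel regular
  outer measure induces on its measurable sets. An open subset \<open>\<Omega>\<close> with restricted metric and measure
  is represented by \<open>restrict_space \<mu> \<Omega>\<close>, so the notions below take a measure \<open>M\<close> and refer to the
  space only through \<open>space M\<close>. Functions on \<open>\<Omega>\<close> are total functions whose values off
  \<open>\<Omega>\<close> are irrelevant.\<close>

definition metric_measure :: "'a::metric_space measure \<Rightarrow> bool" where
  "metric_measure \<mu> \<longleftrightarrow> space \<mu> = UNIV \<and> sets borel \<subseteq> sets \<mu> \<and> complete_measure \<mu> \<and>
     (\<forall>E\<in>sets \<mu>. \<exists>B\<in>sets borel. E \<subseteq> B \<and> emeasure \<mu> B = emeasure \<mu> E)"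

definition doubling :: "'a::metric_space measure \<Rightarrow> bool" where
  "doubling \<mu> \<longleftrightarrow> (\<exists>C\<ge>1::real. \<forall>x r. 0 < r \<longrightarrow>
     0 < emeasure \<mu> (ball x (2 * r)) \<and>
     emeasure \<mu> (ball x (2 * r)) \<le> ennreal C * emeasure \<mu> (ball x r) \<and>
     ennreal C * emeasure \<mu> (ball x r) < \<infinity>)"

definition epowr :: "ennreal \<Rightarrow> real \<Rightarrow> ennreal" where
  "epowr x q = (if x = \<infinity> then \<infinity> else ennreal (enn2real x powr q))"
  \<comment> \<open>only used for \<open>q > 0\<close>\<close>

definition Lp_fun :: "real \<Rightarrow> 'a measure \<Rightarrow> ('a \<Rightarrow> real) set" where
  "Lp_fun q M = {u \<in> borel_measurable M. integrable M (\<lambda>x. \<bar>u x\<bar> powr q)}"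

definition avg :: "'a measure \<Rightarrow> 'a set \<Rightarrow> ('a \<Rightarrow> ennreal) \<Rightarrow> ennreal" where
  "avg \<mu> B h = (\<integral>\<^sup>+x\<in>B. h x \<partial>\<mu>) / emeasure \<mu> B"

text \<open>A compact curve \<open>\<gamma> : [a,b] \<rightarrow> X\<close> is a triple \<open>(a, b, \<gamma>)\<close>. Its length is the supremum of the
  lengths of inscribed polygons.\<close>

type_synonym 'a curve = "real \<times> real \<times> (real \<Rightarrow> 'a)"

definition curve_length :: "real \<Rightarrow> real \<Rightarrow> (real \<Rightarrow> 'a::metric_space) \<Rightarrow> ennreal" where
  "curve_length a b \<gamma> = (SUP ts \<in> {ts. sorted ts \<and> set ts \<subseteq> {a..b}}.
     ennreal (\<Sum>i<length ts - 1. dist (\<gamma> (ts ! i)) (\<gamma> (ts ! Suc i))))"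

definition curves :: "'a::metric_space set \<Rightarrow> 'a curve set" where
  "curves S = {(a, b, \<gamma>). a < b \<and> continuous_on {a..b} \<gamma> \<and> \<gamma> ` {a..b} \<subseteq> S \<and>
     curve_length a b \<gamma> < \<infinity> \<and> (\<exists>s\<in>{a..b}. \<exists>t\<in>{a..b}. \<gamma> s \<noteq> \<gamma> t)}"

text \<open>Arc length parametrization; the value does not depend on the chosen \<open>s\<close>, since \<open>\<gamma>\<close> is constant
  on every interval along which its length does not increase.\<close>

definition arclength_param :: "real \<Rightarrow> real \<Rightarrow> (real \<Rightarrow> 'a::metric_space) \<Rightarrow> real \<Rightarrow> 'a" where
  "arclength_param a b \<gamma> t = \<gamma> (SOME s. s \<in> {a..b} \<and> curve_length a s \<gamma> = ennreal t)"

definition line_integral :: "'a::metric_space curve \<Rightarrow> ('a \<Rightarrow> ennreal) \<Rightarrow> ennreal" where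
  "line_integral c h = (case c of (a, b, \<gamma>) \<Rightarrow>
     \<integral>\<^sup>+t\<in>{0..enn2real (curve_length a b \<gamma>)}. h (arclength_param a b \<gamma> t) \<partial>lborel)"

definition geodesic_metric :: "'a::metric_space itself \<Rightarrow> bool" where
  "geodesic_metric _ \<longleftrightarrow> (\<forall>x y :: 'a. \<exists>a b \<gamma>. a \<le> b \<and> continuous_on {a..b} \<gamma> \<and>
     \<gamma> a = x \<and> \<gamma> b = y \<and> curve_length a b \<gamma> = ennreal (dist x y))"

definition borel_on :: "'a::metric_space set \<Rightarrow> ('a \<Rightarrow> ennreal) set" where
  "borel_on S = borel_measurable (restrict_space borel S)"

definition modulus :: "real \<Rightarrow> 'a::metric_space measure \<Rightarrow> 'a curve set \<Rightarrow> ennreal" where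
  "modulus p M \<Gamma> = (INF \<rho> \<in> {\<rho> \<in> borel_on (space M). \<forall>c\<in>\<Gamma>. 1 \<le> line_integral c \<rho>}.
     \<integral>\<^sup>+x. epowr (\<rho> x) p \<partial>M)"

definition ug_along :: "('a::metric_space \<Rightarrow> real) \<Rightarrow> ('a \<Rightarrow> ennreal) \<Rightarrow> 'a curve \<Rightarrow> bool" where
  "ug_along u h c \<longleftrightarrow> (case c of (a, b, \<gamma>) \<Rightarrow> ennreal \<bar>u (\<gamma> a) - u (\<gamma> b)\<bar> \<le> line_integral c h)"

definition upper_gradient ::
  "'a::metric_space measure \<Rightarrow> ('a \<Rightarrow> real) \<Rightarrow> ('a \<Rightarrow> ennreal) \<Rightarrow> bool" where
  "upper_gradient M u h \<longleftrightarrow> h \<in> borel_on (space M) \<and> (\<forall>c\<in>curves (space M). ug_along u h c)"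

definition weak_ug ::
  "real \<Rightarrow> 'a::metric_space measure \<Rightarrow> ('a \<Rightarrow> real) \<Rightarrow> ('a \<Rightarrow> ennreal) \<Rightarrow> bool" where
  "weak_ug p M u h \<longleftrightarrow> h \<in> borel_on (space M) \<and>
     (\<exists>\<Gamma>\<subseteq>curves (space M). modulus p M \<Gamma> = 0 \<and> (\<forall>c\<in>curves (space M) - \<Gamma>. ug_along u h c))"

definition newtonian :: "real \<Rightarrow> 'a::metric_space measure \<Rightarrow> ('a \<Rightarrow> real) set" where
  "newtonian p M = {u \<in> Lp_fun p M. \<exists>h. weak_ug p M u h \<and> (\<integral>\<^sup>+x. epowr (h x) p \<partial>M) < \<infinity>}"

text \<open>The minimal \<open>p\<close>-weak upper gradient is determined only up to null sets, so it is a relation: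
  \<open>g\<close> is a representative of \<open>g\<^sub>u\<close>.\<close>

definition min_weak_ug ::
  "real \<Rightarrow> 'a::metric_space measure \<Rightarrow> ('a \<Rightarrow> real) \<Rightarrow> ('a \<Rightarrow> ennreal) \<Rightarrow> bool" where
  "min_weak_ug p M u g \<longleftrightarrow> weak_ug p M u g \<and> (\<integral>\<^sup>+x. epowr (g x) p \<partial>M) < \<infinity> \<and>
     (\<forall>h. weak_ug p M u h \<longrightarrow> (\<integral>\<^sup>+x. epowr (g x) p \<partial>M) \<le> (\<integral>\<^sup>+x. epowr (h x) p \<partial>M))"

definition newtonian_zero ::
  "real \<Rightarrow> 'a::metric_space measure \<Rightarrow> 'a set \<Rightarrow> ('a \<Rightarrow> real) set" where
  "newtonian_zero p \<mu> \<Omega> = {\<phi>. \<exists>w\<in>newtonian p \<mu>. (\<forall>x. x \<notin> \<Omega> \<longrightarrow> w x = 0) \<and> (\<forall>x\<in>\<Omega>. \<phi> x = w x)}"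

definition newtonian_loc :: "real \<Rightarrow> 'a::metric_space measure \<Rightarrow> ('a \<Rightarrow> real) set" where
  "newtonian_loc p \<mu> = {u. \<forall>x. \<exists>r>0. u \<in> newtonian p (restrict_space \<mu> (ball x r))}"

text \<open>Representatives of \<open>g\<^sub>u\<close> for \<open>u\<close> that is only locally Newtonian. Restricting a minimal weak upper
  gradient to an open set keeps it minimal, so this is consistent with \<open>min_weak_ug\<close>.\<close>

definition loc_min_weak_ug ::
  "real \<Rightarrow> 'a::metric_space measure \<Rightarrow> ('a \<Rightarrow> real) \<Rightarrow> ('a \<Rightarrow> ennreal) \<Rightarrow> bool" where
  "loc_min_weak_ug p \<mu> u g \<longleftrightarrow> (\<forall>x. \<exists>r>0. min_weak_ug p (restrict_space \<mu> (ball x r)) u g)"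

definition poincare :: "real \<Rightarrow> 'a::metric_space measure \<Rightarrow> bool" where
  "poincare p \<mu> \<longleftrightarrow> (\<exists>C>0::real. \<exists>k\<ge>1::real. \<forall>u h x r.
     integrable \<mu> u \<longrightarrow> upper_gradient \<mu> u h \<longrightarrow> 0 < r \<longrightarrow>
     (let B = ball x r; uB = (LINT y:B|\<mu>. u y) / measure \<mu> B in
        epowr (avg \<mu> B (\<lambda>y. ennreal (\<bar>u y - uB\<bar> powr p))) (1 / p)
          \<le> ennreal (C * r) * epowr (avg \<mu> (ball x (k * r)) (\<lambda>y. epowr (h y) p)) (1 / p)))"

definition lebesgue_value ::
  "'a::metric_space measure \<Rightarrow> ('a \<Rightarrow> real) \<Rightarrow> 'a \<Rightarrow> real \<Rightarrow> bool" where
  "lebesgue_value \<mu> w x c \<longleftrightarrow>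
     ((\<lambda>r. avg \<mu> (ball x r) (\<lambda>y. ennreal \<bar>w y - c\<bar>)) \<longlongrightarrow> 0) (at_right 0)"

text \<open>The relation \<open>g\<^sub>u(x) = c\<close> at an individual point, read as: \<open>x\<close> is a Lebesgue point of \<open>g\<^sub>u\<^sup>p\<close>
  with value \<open>c\<^sup>p\<close>. This does not depend on the representative of \<open>g\<^sub>u\<close>.\<close>

definition min_ug_at ::
  "real \<Rightarrow> 'a::metric_space measure \<Rightarrow> ('a \<Rightarrow> real) \<Rightarrow> 'a \<Rightarrow> real \<Rightarrow> bool" where
  "min_ug_at p \<mu> u x c \<longleftrightarrow> 0 \<le> c \<and>
     (\<exists>g. loc_min_weak_ug p \<mu> u g \<and> lebesgue_value \<mu> (\<lambda>y. enn2real (g y) powr p) x (c powr p))"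

definition newtonian_cpt ::
  "real \<Rightarrow> 'a::metric_space measure \<Rightarrow> 'a set \<Rightarrow> ('a \<Rightarrow> real) set" where
  "newtonian_cpt p \<mu> B = {\<phi> \<in> newtonian p \<mu>. compact (closure {x. \<phi> x \<noteq> 0}) \<and> closure {x. \<phi> x \<noteq> 0} \<subseteq> B}"

definition asymp_gen_linear ::
  "real \<Rightarrow> 'a::metric_space measure \<Rightarrow> ('a \<Rightarrow> real) \<Rightarrow> 'a \<Rightarrow> bool" where
  "asymp_gen_linear p \<mu> u x \<longleftrightarrow> u \<in> newtonian_loc p \<mu> \<and>
     (\<exists>g. loc_min_weak_ug p \<mu> u g \<and>
        (\<exists>c. lebesgue_value \<mu> (\<lambda>y. enn2real (g y) powr p) x c) \<and>
        ((\<lambda>r. avg \<mu> (ball x r) (\<lambda>y. epowr (g y) p) -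
              Inf {avg \<mu> (ball x r) (\<lambda>y. epowr (h y) p) | \<phi> h.
                     \<phi> \<in> newtonian_cpt p \<mu> (ball x r) \<and> loc_min_weak_ug p \<mu> (\<lambda>y. u y + \<phi> y) h})
          \<longlongrightarrow> 0) (at_right 0))"

text \<open>The dimension bound \<open>N\<close> is \<open>CARD('n)\<close>, and the subspace \<open>\<real>\<^bsup>N(\<alpha>)\<^esup> \<subseteq> \<real>\<^sup>N\<close> consists of
  the vectors supported in a set \<open>I \<alpha>\<close> of coordinates, with \<open>N(\<alpha>) = card (I \<alpha>)\<close>.\<close>

definition coord_space :: "'n set \<Rightarrow> (real ^ 'n) set" where
  "coord_space J = {a. \<forall>j. j \<notin> J \<longrightarrow> a $ j = 0}"

definition lin_comb :: "'n set \<Rightarrow> real ^ 'n \<Rightarrow> ('n \<Rightarrow> 'a \<Rightarrow> real) \<Rightarrow> 'a \<Rightarrow> real" where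
  "lin_comb J a F x = (\<Sum>j\<in>J. a $ j * F j x)"

text \<open>\<open>A\<close> is the countable set of chart indices, \<open>U\<close> the chart domains, \<open>F\<close> the chart coordinates,
  and \<open>V u \<alpha>\<close>, \<open>D u \<alpha>\<close> are the sets \<open>V\<^sub>\<alpha>(u)\<close> and the maps \<open>D\<^sup>\<alpha>u\<close>.\<close>

locale cheeger_structure =
  fixes p :: real
    and \<mu> :: "'a::metric_space measure"
    and A :: "nat set"
    and U :: "nat \<Rightarrow> 'a set"
    and I :: "nat \<Rightarrow> 'n::finite set"
    and F :: "nat \<Rightarrow> 'n \<Rightarrow> 'a \<Rightarrow> real"
    and V :: "('a \<Rightarrow> real) \<Rightarrow> nat \<Rightarrow> 'a set"
    and D :: "('a \<Rightarrow> real) \<Rightarrow> nat \<Rightarrow> 'a \<Rightarrow> real ^ 'n"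
  assumes dom_meas: "\<And>\<alpha>. \<alpha> \<in> A \<Longrightarrow> U \<alpha> \<in> sets \<mu>"
    and dom_pos: "\<And>\<alpha>. \<alpha> \<in> A \<Longrightarrow> 0 < emeasure \<mu> (U \<alpha>)"
    and dom_disjoint: "disjoint_family_on U A"
    and dom_cover: "emeasure \<mu> (UNIV - (\<Union>\<alpha>\<in>A. U \<alpha>)) = 0"
    and coord_lipschitz: "\<And>\<alpha> j. \<alpha> \<in> A \<Longrightarrow> j \<in> I \<alpha> \<Longrightarrow> 1-lipschitz_on UNIV (F \<alpha> j)"
    and coord_agl: "\<And>\<alpha> j x. \<alpha> \<in> A \<Longrightarrow> j \<in> I \<alpha> \<Longrightarrow> x \<in> U \<alpha> \<Longrightarrow> asymp_gen_linear p \<mu> (F \<alpha> j) x"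
    and coord_indep: "\<And>\<alpha> a x. \<alpha> \<in> A \<Longrightarrow> a \<in> coord_space (I \<alpha>) \<Longrightarrow> a \<noteq> 0 \<Longrightarrow> x \<in> U \<alpha> \<Longrightarrow>
      \<exists>c>0. min_ug_at p \<mu> (lin_comb (I \<alpha>) a (F \<alpha>)) x c"
    and diff_dom: "\<And>\<alpha> u L. \<alpha> \<in> A \<Longrightarrow> L-lipschitz_on UNIV u \<Longrightarrow>
      V u \<alpha> \<subseteq> U \<alpha> \<and> U \<alpha> - V u \<alpha> \<in> null_sets \<mu>"
    and diff_borel: "\<And>\<alpha> u L. \<alpha> \<in> A \<Longrightarrow> L-lipschitz_on UNIV u \<Longrightarrow>
      D u \<alpha> \<in> borel_measurable (restrict_space borel (V u \<alpha>))"
    and diff_coord: "\<And>\<alpha> u L x. \<alpha> \<in> A \<Longrightarrow> L-lipschitz_on UNIV u \<Longrightarrow> x \<in> V u \<alpha> \<Longrightarrow>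
      D u \<alpha> x \<in> coord_space (I \<alpha>)"
    and diff_unique: "\<And>\<alpha> u L x a. \<alpha> \<in> A \<Longrightarrow> L-lipschitz_on UNIV u \<Longrightarrow> x \<in> V u \<alpha> \<Longrightarrow>
      a \<in> coord_space (I \<alpha>) \<Longrightarrow>
      min_ug_at p \<mu> (\<lambda>y. lin_comb (I \<alpha>) a (F \<alpha>) y - u y) x 0 \<longleftrightarrow> a = D u \<alpha> x"

definition is_inner_product :: "(real ^ 'n \<Rightarrow> real ^ 'n \<Rightarrow> real) \<Rightarrow> bool" where
  "is_inner_product b \<longleftrightarrow> bilinear b \<and> (\<forall>v w. b v w = b w v) \<and> (\<forall>v. v \<noteq> 0 \<longrightarrow> 0 < b v v)"

definition ip_norm :: "(real ^ 'n \<Rightarrow> real ^ 'n \<Rightarrow> real) \<Rightarrow> real ^ 'n \<Rightarrow> real" where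
  "ip_norm b v = sqrt (b v v)"

text \<open>Since \<open>g\<^sub>u\<close> exists and is unique a.e., it does not matter which representative is taken.\<close>

definition gradient_comparison ::
  "real \<Rightarrow> 'a::metric_space measure \<Rightarrow> ('a \<Rightarrow> real ^ 'n::finite \<Rightarrow> real ^ 'n \<Rightarrow> real) \<Rightarrow>
   ('a \<Rightarrow> real) \<Rightarrow> ('a \<Rightarrow> real ^ 'n) \<Rightarrow> bool" where
  "gradient_comparison p M ip u G \<longleftrightarrow> (\<exists>g. min_weak_ug p M u g \<and>
     (AE x in M. ennreal (ip_norm (ip x) (G x)) \<le> g x \<and>
                 g x \<le> ennreal (sqrt (real CARD('n)) * ip_norm (ip x) (G x))))"

text \<open>Boundedness of \<open>\<nabla>\<close> is stated in the norm of \<open>L\<^sup>p(X:\<real>\<^sup>N)\<close> coming from the pointwise norms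
  \<open>|\<cdot>|\<^sub>x\<close>. In the product rule \<open>uv\<close> is assumed to be in the domain of \<open>\<nabla>\<close>, since \<open>u\<close> and
  \<open>v\<close> may be unbounded. \<open>ip_meas\<close> makes \<open>\<langle>G(x), H(x)\<rangle>\<^sub>x\<close> measurable for measurable \<open>G\<close>, \<open>H\<close>.\<close>

locale cheeger_gradient = cheeger_structure p \<mu> A U I F V D
  for p :: real
    and \<mu> :: "'a::metric_space measure"
    and A :: "nat set"
    and U :: "nat \<Rightarrow> 'a set"
    and I :: "nat \<Rightarrow> 'n::finite set"
    and F :: "nat \<Rightarrow> 'n \<Rightarrow> 'a \<Rightarrow> real"
    and V :: "('a \<Rightarrow> real) \<Rightarrow> nat \<Rightarrow> 'a set"
    and D :: "('a \<Rightarrow> real) \<Rightarrow> nat \<Rightarrow> 'a \<Rightarrow> real ^ 'n" +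
  fixes ip :: "'a \<Rightarrow> real ^ 'n \<Rightarrow> real ^ 'n \<Rightarrow> real"
    and nabla :: "('a \<Rightarrow> real) \<Rightarrow> 'a \<Rightarrow> real ^ 'n"
  assumes ip_inner: "AE x in \<mu>. is_inner_product (ip x)"
    and ip_meas: "\<And>v w. (\<lambda>x. ip x v w) \<in> borel_measurable \<mu>"
    and nabla_meas: "\<And>u. u \<in> newtonian p \<mu> \<Longrightarrow> nabla u \<in> borel_measurable \<mu>"
    and nabla_linear: "\<And>u v s t. u \<in> newtonian p \<mu> \<Longrightarrow> v \<in> newtonian p \<mu> \<Longrightarrow>
      AE x in \<mu>. nabla (\<lambda>y. s * u y + t * v y) x = s *\<^sub>R nabla u x + t *\<^sub>R nabla v x"
    and nabla_bounded: "\<exists>C\<ge>0. \<forall>u g. u \<in> newtonian p \<mu> \<longrightarrow> min_weak_ug p \<mu> u g \<longrightarrow>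
      epowr (\<integral>\<^sup>+x. ennreal (ip_norm (ip x) (nabla u x) powr p) \<partial>\<mu>) (1 / p)
        \<le> ennreal C * epowr (\<integral>\<^sup>+x. ennreal (\<bar>u x\<bar> powr p) + epowr (g x) p \<partial>\<mu>) (1 / p)"
    and nabla_lipschitz: "\<And>u L. u \<in> newtonian p \<mu> \<Longrightarrow> L-lipschitz_on UNIV u \<Longrightarrow>
      AE x in \<mu>. \<forall>\<alpha>\<in>A. x \<in> U \<alpha> \<longrightarrow> nabla u x = D u \<alpha> x"
    and nabla_product: "\<And>u v K L. u \<in> newtonian p \<mu> \<Longrightarrow> v \<in> newtonian p \<mu> \<Longrightarrow>
      K-lipschitz_on UNIV u \<Longrightarrow> L-lipschitz_on UNIV v \<Longrightarrow> (\<lambda>y. u y * v y) \<in> newtonian p \<mu> \<Longrightarrow>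
      AE x in \<mu>. nabla (\<lambda>y. u y * v y) x = u x *\<^sub>R nabla v x + v x *\<^sub>R nabla u x"
    and nabla_comparison: "\<And>u. u \<in> newtonian p \<mu> \<Longrightarrow> gradient_comparison p \<mu> ip u (nabla u)"

definition cutoff :: "'a::metric_space set \<Rightarrow> ('a \<Rightarrow> real) set" where
  "cutoff \<Omega> = {\<eta>. (\<exists>L. L-lipschitz_on UNIV \<eta>) \<and> (\<forall>x. 0 \<le> \<eta> x \<and> \<eta> x \<le> 1) \<and>
     compact (closure {x. \<eta> x \<noteq> 0}) \<and> closure {x. \<eta> x \<noteq> 0} \<subseteq> \<Omega>}"

text \<open>The gradient on \<open>N\<^sup>1\<^sup>,\<^sup>p(\<Omega>)\<close>. The locality condition determines \<open>nabla\<^sub>\<Omega> u\<close> a.e. in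
  \<open>\<Omega>\<close>; the function \<open>\<eta> u\<close> is the zero extension.\<close>

locale cheeger_gradient_on =
  fixes p :: real
    and \<mu> :: "'a::metric_space measure"
    and \<Omega> :: "'a set"
    and ip :: "'a \<Rightarrow> real ^ 'n::finite \<Rightarrow> real ^ 'n \<Rightarrow> real"
    and nabla :: "('a \<Rightarrow> real) \<Rightarrow> 'a \<Rightarrow> real ^ 'n"
    and nabla\<^sub>\<Omega> :: "('a \<Rightarrow> real) \<Rightarrow> 'a \<Rightarrow> real ^ 'n"
  assumes on_meas: "\<And>u. u \<in> newtonian p (restrict_space \<mu> \<Omega>) \<Longrightarrow>
      nabla\<^sub>\<Omega> u \<in> borel_measurable (restrict_space \<mu> \<Omega>)"
    and on_local: "\<And>u \<eta>. u \<in> newtonian p (restrict_space \<mu> \<Omega>) \<Longrightarrow> \<eta> \<in> cutoff \<Omega> \<Longrightarrow>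
      AE x in \<mu>. \<eta> x = 1 \<longrightarrow> nabla\<^sub>\<Omega> u x = nabla (\<lambda>y. \<eta> y * u y) x"
    and on_linear: "\<And>u v s t. u \<in> newtonian p (restrict_space \<mu> \<Omega>) \<Longrightarrow>
      v \<in> newtonian p (restrict_space \<mu> \<Omega>) \<Longrightarrow>
      AE x in restrict_space \<mu> \<Omega>.
        nabla\<^sub>\<Omega> (\<lambda>y. s * u y + t * v y) x = s *\<^sub>R nabla\<^sub>\<Omega> u x + t *\<^sub>R nabla\<^sub>\<Omega> v x"
    and on_comparison: "\<And>u. u \<in> newtonian p (restrict_space \<mu> \<Omega>) \<Longrightarrow>
      gradient_comparison p (restrict_space \<mu> \<Omega>) ip u (nabla\<^sub>\<Omega> u)"

definition J_C ::
  "real \<Rightarrow> 'a measure \<Rightarrow> 'a set \<Rightarrow> ('a \<Rightarrow> real ^ 'n \<Rightarrow> real ^ 'n \<Rightarrow> real) \<Rightarrow>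
   (('a \<Rightarrow> real) \<Rightarrow> 'a \<Rightarrow> real ^ 'n) \<Rightarrow> ('a \<Rightarrow> real) \<Rightarrow> ('a \<Rightarrow> real) \<Rightarrow> real" where
  "J_C p \<mu> \<Omega> ip G f v =
     (LINT x:\<Omega>|\<mu>. ip_norm (ip x) (G v x) powr p) - p * (LINT x:\<Omega>|\<mu>. f x * v x)"

end

theory Submission
  imports Defs
begin

text \<open>The functional \<open>J_C\<close> is convex, and the weak equation says that its derivative at \<open>u\<close> vanishes
  in every admissible direction. For a convex function this is equivalent to minimality. Two things have
  to be supplied.

  The first is the calculus of the energy \<open>G \<mapsto> \<integral>|G|\<^sub>x\<^sup>p d\<mu>\<close> on \<open>L\<^sup>p\<close> vector fields. Everything
  follows from the pointwise tangent inequality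
  \<open>|v|\<^sup>p + p |v|\<^sup>p\<^sup>-\<^sup>2 \<langle>v, w - v\<rangle> \<le> |w|\<^sup>p\<close> (\<open>p_flux_tangent\<close>), a consequence of
  Cauchy-Schwarz and Young. Integrated at \<open>G\<close>, it shows that the energy lies above its linearization.
  Integrated at \<open>G + t H\<close>, it bounds the difference quotients for \<open>t > 0\<close> from above by \<open>p\<close> times
  the flux integral at \<open>G + t H\<close>, which converges to the one at \<open>G\<close> by dominated convergence. Together these give
  \<open>energy_first_variation_iff\<close>: the line \<open>t \<mapsto> t c\<close> stays below the increment of the energy along
  \<open>H\<close> for all real \<open>t\<close> if and only if \<open>c\<close> is the derivative of the energy in that direction.

  The second is that \<open>u + t \<phi>\<close> is a legitimate competitor and that its gradient is
  \<open>\<nabla>u + t \<nabla>\<phi>\<close>. The latter is linearity of the Cheeger gradient; it requires that \<open>N\<^sup>1\<^sup>,\<^sup>p\<close> is a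
  vector space (\<open>newtonian_linear\<close>) containing \<open>N\<^sub>0\<^sup>1\<^sup>,\<^sup>p(\<Omega>)\<close>
  (\<open>newtonian_restrict_space\<close>). These facts about weak upper gradients reduce to
  superadditivity of line integrals and to the union of two families of modulus zero.

  The source term is paired with Newtonian functions through Young's inequality, and the gradients have
  finite energy because they are dominated by minimal weak upper gradients.\<close>

section \<open>Inner products and the flux of the p-energy\<close>

lemma is_inner_productD:
  assumes "is_inner_product b"
  shows "b (v + w) z = b v z + b w z" "b z (v + w) = b z v + b z w"
    "b (c *\<^sub>R v) w = c * b v w" "b v (c *\<^sub>R w) = c * b v w"
    "b (v - w) z = b v z - b w z" "b z (v - w) = b z v - b z w"
    "b 0 v = 0" "b v 0 = 0" "b v w = b w v" "0 \<le> b v v"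
proof -
  have bil: "bilinear b" and sym: "\<And>v w. b v w = b w v" and pos: "\<And>v. v \<noteq> 0 \<Longrightarrow> 0 < b v v"
    using assms by (auto simp: is_inner_product_def)
  show z: "b 0 v = 0" using bilinear_lzero[OF bil] .
  show "0 \<le> b v v" using pos[of v] z by (cases "v = 0") (auto simp: bilinear_lzero[OF bil])
  show "b (v + w) z = b v z + b w z" "b z (v + w) = b z v + b z w"
    "b (c *\<^sub>R v) w = c * b v w" "b v (c *\<^sub>R w) = c * b v w"
    "b (v - w) z = b v z - b w z" "b z (v - w) = b z v - b z w" "b v 0 = 0"
    using bilinear_ladd[OF bil] bilinear_radd[OF bil] bilinear_lmul[OF bil] bilinear_rmul[OF bil]
      bilinear_lsub[OF bil] bilinear_rsub[OF bil] bilinear_rzero[OF bil] by auto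
  show "b v w = b w v" by (rule sym)
qed

lemma ip_norm_nonneg [simp]: "is_inner_product b \<Longrightarrow> 0 \<le> ip_norm b v"
  by (simp add: ip_norm_def is_inner_productD)

lemma ip_norm_power2: "is_inner_product b \<Longrightarrow> (ip_norm b v)\<^sup>2 = b v v"
  by (simp add: ip_norm_def is_inner_productD)

lemma ip_norm_scaleR: "is_inner_product b \<Longrightarrow> ip_norm b (c *\<^sub>R v) = \<bar>c\<bar> * ip_norm b v"
  using real_sqrt_mult[of "c\<^sup>2" "b v v"]
  by (simp add: ip_norm_def is_inner_productD(3,4) power2_eq_square mult.assoc)

lemma ip_norm_eq_0_iff: "is_inner_product b \<Longrightarrow> ip_norm b v = 0 \<longleftrightarrow> v = 0"
  by (metis ip_norm_def is_inner_productD(7) is_inner_product_def less_irrefl real_sqrt_eq_zero_cancel_iff)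

text \<open>The inner products here are arbitrary bilinear forms on \<open>\<real>\<^sup>N\<close> that vary with the point, so
  the inequality is derived for them from nonnegativity of the squared distance from \<open>w\<close> to the
  line spanned by \<open>v\<close>.\<close>

lemma ip_Cauchy_Schwarz:
  assumes b: "is_inner_product b"
  shows "\<bar>b v w\<bar> \<le> ip_norm b v * ip_norm b w"
proof (cases "v = 0")
  case True
  then show ?thesis using b by (simp add: is_inner_productD ip_norm_def)
next
  case False
  then have pos: "0 < b v v" using b by (auto simp: is_inner_product_def)
  \<comment> \<open>The coefficient of the orthogonal projection of \<open>w\<close> onto \<open>v\<close>.\<close>
  define s where "s = b v w / b v v"
  have "0 \<le> b (w - s *\<^sub>R v) (w - s *\<^sub>R v)" using b by (rule is_inner_productD)
  also have "\<dots> = b w w - 2 * s * b v w + s * s * b v v"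
    by (simp add: is_inner_productD[OF b] is_inner_productD(9)[OF b, of w v] algebra_simps)
  also have "\<dots> = b w w - (b v w)\<^sup>2 / b v v"
    using pos by (simp add: s_def field_simps power2_eq_square)
  finally have "(b v w)\<^sup>2 \<le> b v v * b w w" using pos by (simp add: field_simps)
  then have "sqrt ((b v w)\<^sup>2) \<le> sqrt (b v v * b w w)" by (rule real_sqrt_le_mono)
  then show ?thesis by (simp add: ip_norm_def real_sqrt_mult)
qed

lemma ip_norm_triangle:
  assumes b: "is_inner_product b"
  shows "ip_norm b (v + w) \<le> ip_norm b v + ip_norm b w"
proof (rule power2_le_imp_le)
  have "b v w \<le> ip_norm b v * ip_norm b w"
    using ip_Cauchy_Schwarz[OF b, of v w] by simp
  then show "(ip_norm b (v + w))\<^sup>2 \<le> (ip_norm b v + ip_norm b w)\<^sup>2"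
    by (simp add: power2_sum ip_norm_power2[OF b] is_inner_productD[OF b]
        is_inner_productD(9)[OF b, of w v])
qed (use b in auto)

text \<open>The expression \<open>|v|\<^sup>p\<^sup>-\<^sup>2 \<langle>v, w\<rangle>\<close> of the weak equation, which is the derivative of
  \<open>|\<cdot>|\<^sup>p / p\<close> at \<open>v\<close> in the direction \<open>w\<close>. At \<open>v = 0\<close> it vanishes, also when \<open>p < 2\<close>,
  and this is the right value because \<open>p > 1\<close>.\<close>

definition p_flux :: "real \<Rightarrow> (real ^ 'n \<Rightarrow> real ^ 'n \<Rightarrow> real) \<Rightarrow> real ^ 'n \<Rightarrow> real ^ 'n \<Rightarrow> real" where
  "p_flux p b v w = ip_norm b v powr (p - 2) * b v w"

lemma p_flux_linear:
  "is_inner_product b \<Longrightarrow> p_flux p b v (s *\<^sub>R w + t *\<^sub>R z) = s * p_flux p b v w + t * p_flux p b v z"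
  by (simp add: p_flux_def is_inner_productD algebra_simps)

lemma p_flux_le:
  assumes b: "is_inner_product b"
  shows "\<bar>p_flux p b v w\<bar> \<le> ip_norm b v powr (p - 1) * ip_norm b w"
proof -
  have "\<bar>p_flux p b v w\<bar> \<le> ip_norm b v powr (p - 2) * (ip_norm b v * ip_norm b w)"
    using ip_Cauchy_Schwarz[OF b, of v w] by (simp add: p_flux_def abs_mult mult_left_mono)
  also have "\<dots> = ip_norm b v powr (p - 1) * ip_norm b w"
  proof (cases "ip_norm b v = 0")
    case False
    then have "0 < ip_norm b v" using ip_norm_nonneg[OF b, of v] by simp
    then have "ip_norm b v powr (p - 1) = ip_norm b v powr (p - 2) * ip_norm b v"
      using powr_add[of "ip_norm b v" "p - 2" 1] by simp
    then show ?thesis by simp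
  qed simp
  finally show ?thesis .
qed

lemma p_flux_self:
  assumes b: "is_inner_product b"
  shows "p_flux p b v v = ip_norm b v powr p"
proof (cases "ip_norm b v = 0")
  case False
  then have "0 < ip_norm b v" using ip_norm_nonneg[OF b, of v] by simp
  then show ?thesis
    using powr_add[of "ip_norm b v" "p - 2" 2]
    by (simp add: p_flux_def ip_norm_power2[OF b])
qed (simp add: p_flux_def)

text \<open>Young's inequality for the conjugate exponents \<open>p / (p - 1)\<close> and \<open>p\<close>, applied to \<open>x\<^sup>p\<^sup>-\<^sup>1\<close> and \<open>y\<close>.\<close>

lemma powr_Young:
  fixes p x y :: real
  assumes "1 < p" "0 \<le> x" "0 \<le> y"
  shows "x powr (p - 1) * y \<le> (1 - 1 / p) * x powr p + y powr p / p"
proof -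
  have "x powr (p - 1) * y \<le> (x powr (p - 1)) powr (p / (p - 1)) / (p / (p - 1)) + y powr p / p"
    using assms by (intro Youngs_inequality) (auto simp: field_simps)
  also have "(x powr (p - 1)) powr (p / (p - 1)) = x powr p"
    using assms by (simp add: powr_powr)
  finally show ?thesis using assms by (simp add: field_simps)
qed

lemma powr_Young_le_sum:
  fixes p x y :: real
  assumes "1 < p" "0 \<le> x" "0 \<le> y"
  shows "x powr (p - 1) * y \<le> x powr p + y powr p"
proof -
  have "(1 - 1 / p) * x powr p \<le> 1 * x powr p" using assms by (intro mult_right_mono) auto
  moreover have "y powr p / p \<le> y powr p"
    using assms mult_right_mono[of 1 p "y powr p"] by (simp add: divide_le_eq mult.commute)
  ultimately show ?thesis using powr_Young[OF assms] by simp
qed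

text \<open>The convex function \<open>|\<cdot>|\<^sup>p\<close> lies above its tangent plane at \<open>v\<close>. Indeed,
  Cauchy-Schwarz and Young bound \<open>|v|\<^sup>p\<^sup>-\<^sup>2 \<langle>v, w\<rangle>\<close> by a combination of \<open>|v|\<^sup>p\<close> and
  \<open>|w|\<^sup>p\<close> with the correct constants.\<close>

lemma p_flux_tangent:
  assumes b: "is_inner_product b" and p: "1 < p"
  shows "p * p_flux p b v (w - v) \<le> ip_norm b w powr p - ip_norm b v powr p"
proof -
  have "p_flux p b v w \<le> (1 - 1 / p) * ip_norm b v powr p + ip_norm b w powr p / p"
    using p_flux_le[OF b, of p v w] powr_Young[OF p, of "ip_norm b v" "ip_norm b w"] b by simp
  then have "p * p_flux p b v w \<le> p * ((1 - 1 / p) * ip_norm b v powr p + ip_norm b w powr p / p)"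
    using p by (intro mult_left_mono) auto
  also have "\<dots> = (p - 1) * ip_norm b v powr p + ip_norm b w powr p"
    using p by (simp add: field_simps)
  finally have "p * p_flux p b v w \<le> (p - 1) * ip_norm b v powr p + ip_norm b w powr p" .
  moreover have "p_flux p b v (w - v) = p_flux p b v w - ip_norm b v powr p"
    using p_flux_linear[OF b, of p v 1 w "-1" v] p_flux_self[OF b, of p v] by simp
  ultimately show ?thesis by (simp only:) (simp add: algebra_simps)
qed

lemma tendsto_ip_norm_line:
  assumes b: "is_inner_product b"
  shows "((\<lambda>t. ip_norm b (v + t *\<^sub>R w)) \<longlongrightarrow> ip_norm b v) (at 0)"
proof -
  have "ip_norm b (v + t *\<^sub>R w) = sqrt (b v v + 2 * t * b v w + t * t * b w w)" for t
    by (simp add: ip_norm_def is_inner_productD[OF b] is_inner_productD(9)[OF b, of w v]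
        algebra_simps)
  moreover have "((\<lambda>t. sqrt (b v v + 2 * t * b v w + t * t * b w w))
      \<longlongrightarrow> sqrt (b v v + 2 * 0 * b v w + 0 * 0 * b w w)) (at 0)"
    by (intro tendsto_intros)
  ultimately show ?thesis by (simp add: ip_norm_def)
qed

text \<open>The factor \<open>|v|\<^sup>p\<^sup>-\<^sup>2\<close> is singular at \<open>v = 0\<close> when \<open>p < 2\<close>. There the flux is controlled by
  \<open>|v + t w|\<^sup>p\<^sup>-\<^sup>1 |w|\<close>, which tends to \<open>0\<close>.\<close>

lemma tendsto_p_flux_line:
  assumes b: "is_inner_product b" and p: "1 < p"
  shows "((\<lambda>t. p_flux p b (v + t *\<^sub>R w) w) \<longlongrightarrow> p_flux p b v w) (at 0)"
proof (cases "v = 0")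
  case True
  have "((\<lambda>t. ip_norm b (v + t *\<^sub>R w) powr (p - 1) * ip_norm b w)
      \<longlongrightarrow> ip_norm b v powr (p - 1) * ip_norm b w) (at 0)"
    using b p by (intro tendsto_intros tendsto_powr' tendsto_ip_norm_line) auto
  then have "((\<lambda>t. ip_norm b (v + t *\<^sub>R w) powr (p - 1) * ip_norm b w) \<longlongrightarrow> 0) (at 0)"
    using True by (simp add: ip_norm_def is_inner_productD[OF b])
  then have "((\<lambda>t. p_flux p b (v + t *\<^sub>R w) w) \<longlongrightarrow> 0) (at 0)"
    by (rule Lim_null_comparison[rotated]) (use p_flux_le[OF b] in auto)
  then show ?thesis using True by (simp add: p_flux_def is_inner_productD[OF b])
next
  case False
  then have "ip_norm b v \<noteq> 0" using b by (simp add: ip_norm_eq_0_iff)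
  moreover have "((\<lambda>t. b v w + t * b w w) \<longlongrightarrow> b v w + 0 * b w w) (at 0)"
    by (intro tendsto_intros)
  ultimately show ?thesis
    unfolding p_flux_def is_inner_productD(1,3)[OF b]
    using b by (intro tendsto_mult tendsto_powr tendsto_ip_norm_line) auto
qed

lemma powr_add_le:
  fixes p x y :: real
  assumes "0 \<le> p" "0 \<le> x" "0 \<le> y"
  shows "(x + y) powr p \<le> 2 powr p * (x powr p + y powr p)"
proof -
  have "(x + y) powr p \<le> (2 * max x y) powr p"
    using assms by (intro powr_mono2) auto
  also have "\<dots> = 2 powr p * max x y powr p" using assms by (simp add: powr_mult)
  also have "\<dots> \<le> 2 powr p * (x powr p + y powr p)"
    by (intro mult_left_mono) (auto simp: max_def)
  finally show ?thesis .
qed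

section \<open>Energies of vector fields\<close>

lemma complete_measure_restrict_space:
  assumes "complete_measure M" "\<Omega> \<in> sets M"
  shows "complete_measure (restrict_space M \<Omega>)"
proof
  interpret complete_measure M by fact
  fix A B assume "A \<subseteq> B" "B \<in> null_sets (restrict_space M \<Omega>)"
  then have "B \<subseteq> \<Omega>" "A \<in> sets M"
    using complete by (auto simp: null_sets_restrict_space assms)
  then show "A \<in> sets (restrict_space M \<Omega>)"
    using \<open>A \<subseteq> B\<close> assms by (auto simp: sets_restrict_space)
qed

text \<open>The forms \<open>ip x\<close> are bilinear only at almost every \<open>x\<close>, so identities that rest on
  bilinearity hold almost everywhere. Completeness of the measure lets measurability pass through them.\<close>

lemma (in complete_measure) measurable_AE_eq:
  fixes f g :: "'a \<Rightarrow> 'b::topological_space"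
  assumes ae: "AE x in M. f x = g x" and f: "f \<in> borel_measurable M"
  shows "g \<in> borel_measurable M"
proof (rule measurableI)
  fix S :: "'b set" assume S: "S \<in> sets borel"
  show "g -` S \<inter> space M \<in> sets M"
  proof (rule in_sets_AE)
    show "AE x in M. x \<in> f -` S \<inter> space M \<longleftrightarrow> x \<in> g -` S \<inter> space M"
      using ae by eventually_elim simp
    show "f -` S \<inter> space M \<in> sets M" using f S by (rule measurable_sets)
  qed simp
qed simp

locale inner_product_field = complete_measure M
  for M :: "'a measure" +
  fixes ip :: "'a \<Rightarrow> real ^ 'n::finite \<Rightarrow> real ^ 'n \<Rightarrow> real"
  assumes ip_inner: "AE x in M. is_inner_product (ip x)"
    and ip_meas: "\<And>v w. (\<lambda>x. ip x v w) \<in> borel_measurable M"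
begin

text \<open>The expansion of \<open>ip x\<close> in the standard basis is a finite sum of products of measurable functions;
  it is valid at almost every \<open>x\<close>, namely where \<open>ip x\<close> is bilinear.\<close>

lemma ip_measurable [measurable (raw)]:
  assumes [measurable]: "G \<in> borel_measurable M" "H \<in> borel_measurable M"
  shows "(\<lambda>x. ip x (G x) (H x)) \<in> borel_measurable M"
proof (rule measurable_AE_eq)
  show "(\<lambda>x. \<Sum>i\<in>UNIV. \<Sum>j\<in>UNIV. (G x \<bullet> axis i 1) * (H x \<bullet> axis j 1) * ip x (axis i 1) (axis j 1))
      \<in> borel_measurable M"
    using ip_meas by measurable
  show "AE x in M. (\<Sum>i\<in>UNIV. \<Sum>j\<in>UNIV. (G x \<bullet> axis i 1) * (H x \<bullet> axis j 1) * ip x (axis i 1) (axis j 1))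
      = ip x (G x) (H x)"
    using ip_inner
  proof eventually_elim
    case (elim x)
    then have bil: "bilinear (ip x)" by (simp add: is_inner_product_def)
    have exp: "v = (\<Sum>i\<in>UNIV. (v \<bullet> axis i 1) *\<^sub>R axis i 1)" for v :: "real ^ 'n"
      using basis_expansion[of v] by (simp add: inner_axis scalar_mult_eq_scaleR)
    have "ip x (G x) (H x) = ip x (\<Sum>i\<in>UNIV. (G x \<bullet> axis i 1) *\<^sub>R axis i 1)
        (\<Sum>j\<in>UNIV. (H x \<bullet> axis j 1) *\<^sub>R axis j 1)"
      using exp by metis
    also have "\<dots> = (\<Sum>(i, j)\<in>UNIV \<times> UNIV.
        ip x ((G x \<bullet> axis i 1) *\<^sub>R axis i 1) ((H x \<bullet> axis j 1) *\<^sub>R axis j 1))"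
      by (rule bilinear_sum[OF bil])
    also have "\<dots> = (\<Sum>i\<in>UNIV. \<Sum>j\<in>UNIV.
        (G x \<bullet> axis i 1) * (H x \<bullet> axis j 1) * ip x (axis i 1) (axis j 1))"
      by (simp add: sum.cartesian_product is_inner_productD(3,4)[OF elim] mult_ac del: UNIV_Times_UNIV)
    finally show ?case ..
  qed
qed

lemma ip_norm_measurable [measurable (raw)]:
  "G \<in> borel_measurable M \<Longrightarrow> (\<lambda>x. ip_norm (ip x) (G x)) \<in> borel_measurable M"
  unfolding ip_norm_def by measurable

lemma p_flux_measurable [measurable (raw)]:
  assumes "G \<in> borel_measurable M" "H \<in> borel_measurable M"
  shows "(\<lambda>x. p_flux p (ip x) (G x) (H x)) \<in> borel_measurable M"
proof -
  note [measurable] = ip_measurable[OF assms] ip_norm_measurable[OF assms(1)]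
  show ?thesis unfolding p_flux_def by measurable
qed

definition Lp_field :: "real \<Rightarrow> ('a \<Rightarrow> real ^ 'n) set" where
  "Lp_field p = {G \<in> borel_measurable M. integrable M (\<lambda>x. ip_norm (ip x) (G x) powr p)}"

definition energy :: "real \<Rightarrow> ('a \<Rightarrow> real ^ 'n) \<Rightarrow> real" where
  "energy p G = (LINT x|M. ip_norm (ip x) (G x) powr p)"

lemma Lp_fieldD:
  assumes "G \<in> Lp_field p"
  shows "G \<in> borel_measurable M" "integrable M (\<lambda>x. ip_norm (ip x) (G x) powr p)"
  using assms by (auto simp: Lp_field_def)

lemma Lp_field_scaleR:
  assumes "G \<in> Lp_field p"
  shows "(\<lambda>x. c *\<^sub>R G x) \<in> Lp_field p"
proof -
  note [measurable] = Lp_fieldD(1)[OF assms]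
  have "integrable M (\<lambda>x. \<bar>c\<bar> powr p * ip_norm (ip x) (G x) powr p)"
    using Lp_fieldD(2)[OF assms] by simp
  moreover have "AE x in M. \<bar>c\<bar> powr p * ip_norm (ip x) (G x) powr p = ip_norm (ip x) (c *\<^sub>R G x) powr p"
    using ip_inner by eventually_elim (simp add: ip_norm_scaleR powr_mult)
  ultimately have "integrable M (\<lambda>x. ip_norm (ip x) (c *\<^sub>R G x) powr p)"
    by (subst (asm) integrable_cong_AE) auto
  then show ?thesis by (simp add: Lp_field_def)
qed

lemma ip_norm_add_powr_le:
  assumes "0 \<le> p"
  shows "AE x in M. ip_norm (ip x) (G x + H x) powr p
    \<le> 2 powr p * (ip_norm (ip x) (G x) powr p + ip_norm (ip x) (H x) powr p)"
  using ip_inner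
proof eventually_elim
  case (elim x)
  have "ip_norm (ip x) (G x + H x) powr p \<le> (ip_norm (ip x) (G x) + ip_norm (ip x) (H x)) powr p"
    using elim assms ip_norm_triangle by (intro powr_mono2) auto
  also have "\<dots> \<le> 2 powr p * (ip_norm (ip x) (G x) powr p + ip_norm (ip x) (H x) powr p)"
    using elim assms by (intro powr_add_le) auto
  finally show ?case .
qed

lemma Lp_field_add:
  assumes "0 \<le> p" and G: "G \<in> Lp_field p" and H: "H \<in> Lp_field p"
  shows "(\<lambda>x. G x + H x) \<in> Lp_field p"
proof -
  note [measurable] = Lp_fieldD(1)[OF G] Lp_fieldD(1)[OF H]
  have "integrable M (\<lambda>x. ip_norm (ip x) (G x + H x) powr p)"
  proof (rule Bochner_Integration.integrable_bound)
    show "integrable M (\<lambda>x. 2 powr p * (ip_norm (ip x) (G x) powr p + ip_norm (ip x) (H x) powr p))"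
      using Lp_fieldD(2)[OF G] Lp_fieldD(2)[OF H] by simp
    show "AE x in M. norm (ip_norm (ip x) (G x + H x) powr p)
      \<le> norm (2 powr p * (ip_norm (ip x) (G x) powr p + ip_norm (ip x) (H x) powr p))"
      using ip_norm_add_powr_le[OF assms(1), of G H] by eventually_elim simp
  qed measurable
  then show ?thesis by (simp add: Lp_field_def)
qed

lemma p_flux_bound:
  assumes "1 < p"
  shows "AE x in M. \<bar>p_flux p (ip x) (G x) (H x)\<bar>
    \<le> ip_norm (ip x) (G x) powr p + ip_norm (ip x) (H x) powr p"
  using ip_inner
proof eventually_elim
  case (elim x)
  then show ?case
    using p_flux_le[OF elim, of p "G x" "H x"]
      powr_Young_le_sum[OF assms, of "ip_norm (ip x) (G x)" "ip_norm (ip x) (H x)"] by simp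
qed

lemma p_flux_integrable:
  assumes "1 < p" and G: "G \<in> Lp_field p" and H: "H \<in> Lp_field p"
  shows "integrable M (\<lambda>x. p_flux p (ip x) (G x) (H x))"
proof (rule Bochner_Integration.integrable_bound)
  show "integrable M (\<lambda>x. ip_norm (ip x) (G x) powr p + ip_norm (ip x) (H x) powr p)"
    using Lp_fieldD(2)[OF G] Lp_fieldD(2)[OF H] by simp
  show "AE x in M. norm (p_flux p (ip x) (G x) (H x))
      \<le> norm (ip_norm (ip x) (G x) powr p + ip_norm (ip x) (H x) powr p)"
    using p_flux_bound[OF assms(1), of G H] by eventually_elim simp
qed (intro p_flux_measurable Lp_fieldD(1)[OF G] Lp_fieldD(1)[OF H])

text \<open>Convexity of the energy, as an integrated tangent inequality. This is why a weak solution minimizes.\<close>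

lemma energy_tangent:
  assumes p: "1 < p" and G: "G \<in> Lp_field p" and H: "H \<in> Lp_field p"
  shows "p * (LINT x|M. p_flux p (ip x) (G x) (H x)) \<le> energy p (\<lambda>x. G x + H x) - energy p G"
proof -
  have GH: "(\<lambda>x. G x + H x) \<in> Lp_field p" using p G H by (intro Lp_field_add) auto
  have "p * (LINT x|M. p_flux p (ip x) (G x) (H x)) = (LINT x|M. p * p_flux p (ip x) (G x) (H x))"
    by simp
  also have "\<dots> \<le> (LINT x|M. ip_norm (ip x) (G x + H x) powr p - ip_norm (ip x) (G x) powr p)"
  proof (rule integral_mono_AE)
    show "AE x in M. p * p_flux p (ip x) (G x) (H x)
        \<le> ip_norm (ip x) (G x + H x) powr p - ip_norm (ip x) (G x) powr p"
      using ip_inner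
    proof eventually_elim
      case (elim x)
      then show ?case using p_flux_tangent[OF elim p, of "G x" "G x + H x"] by simp
    qed
  qed (use p_flux_integrable[OF p G H] Lp_fieldD(2)[OF GH] Lp_fieldD(2)[OF G] in auto)
  also have "\<dots> = energy p (\<lambda>x. G x + H x) - energy p G"
    using Lp_fieldD(2)[OF GH] Lp_fieldD(2)[OF G] by (simp add: energy_def)
  finally show ?thesis .
qed

text \<open>Dominated convergence; the majorant comes from Young's inequality and does not depend on \<open>n\<close>
  because the step sizes are at most \<open>1\<close>.\<close>

lemma flux_integral_continuous:
  assumes p: "1 < p" and G: "G \<in> Lp_field p" and H: "H \<in> Lp_field p"
  shows "(\<lambda>n. LINT x|M. p_flux p (ip x) (G x + (1 / real (Suc n)) *\<^sub>R H x) (H x))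
    \<longlonglongrightarrow> (LINT x|M. p_flux p (ip x) (G x) (H x))"
proof (rule integral_dominated_convergence)
  let ?w = "\<lambda>x. 2 powr p * (ip_norm (ip x) (G x) powr p + ip_norm (ip x) (H x) powr p)
    + ip_norm (ip x) (H x) powr p"
  show "integrable M ?w" using Lp_fieldD(2)[OF G] Lp_fieldD(2)[OF H] by simp
  have lim: "filterlim (\<lambda>n. 1 / real (Suc n)) (at 0) sequentially"
    unfolding filterlim_at using LIMSEQ_inverse_real_of_nat
    by (auto simp: inverse_eq_divide)
  show "AE x in M. (\<lambda>n. p_flux p (ip x) (G x + (1 / real (Suc n)) *\<^sub>R H x) (H x))
      \<longlonglongrightarrow> p_flux p (ip x) (G x) (H x)"
    using ip_inner
    by eventually_elim (rule filterlim_compose[OF tendsto_p_flux_line[OF _ p] lim])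
  fix n
  let ?t = "1 / real (Suc n)"
  show "AE x in M. norm (p_flux p (ip x) (G x + ?t *\<^sub>R H x) (H x)) \<le> ?w x"
    using ip_inner p_flux_bound[OF p, of "\<lambda>x. G x + ?t *\<^sub>R H x" H]
      ip_norm_add_powr_le[OF order.trans[OF zero_le_one less_imp_le[OF p]], of G "\<lambda>x. ?t *\<^sub>R H x"]
  proof eventually_elim
    case (elim x)
    have "ip_norm (ip x) (?t *\<^sub>R H x) powr p \<le> ip_norm (ip x) (H x) powr p"
      using elim(1) p
      by (intro powr_mono2) (auto simp: ip_norm_scaleR field_simps mult_left_le_one_le)
    then have "2 powr p * (ip_norm (ip x) (G x) powr p + ip_norm (ip x) (?t *\<^sub>R H x) powr p)
        \<le> 2 powr p * (ip_norm (ip x) (G x) powr p + ip_norm (ip x) (H x) powr p)"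
      by (intro mult_left_mono) auto
    then show ?case unfolding real_norm_def using elim(2,3) by linarith
  qed
qed (intro p_flux_measurable borel_measurable_add borel_measurable_scaleR borel_measurable_const
    Lp_fieldD(1)[OF G] Lp_fieldD(1)[OF H])+

lemma p_flux_integral_scaleR:
  assumes [measurable]: "G \<in> borel_measurable M" "H \<in> borel_measurable M"
  shows "(LINT x|M. p_flux p (ip x) (G x) (t *\<^sub>R H x)) = t * (LINT x|M. p_flux p (ip x) (G x) (H x))"
proof -
  have "(LINT x|M. p_flux p (ip x) (G x) (t *\<^sub>R H x)) = (LINT x|M. t * p_flux p (ip x) (G x) (H x))"
  proof (rule integral_cong_AE)
    show "AE x in M. p_flux p (ip x) (G x) (t *\<^sub>R H x) = t * p_flux p (ip x) (G x) (H x)"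
      using ip_inner
    proof eventually_elim
      case (elim x)
      then show ?case using p_flux_linear[OF elim, of p "G x" t "H x" 0 0] by simp
    qed
  qed measurable
  then show ?thesis by simp
qed

text \<open>The difference quotient of the energy along \<open>H\<close> is bounded above by \<open>p\<close> times the
  flux integral at the \<^emph>\<open>displaced\<close> field \<open>G + t H\<close>, by the tangent inequality taken there. The flux is continuous along the
  line, so letting \<open>t\<close> tend to \<open>0\<close> bounds the slope \<open>c\<close>.\<close>

lemma energy_first_variation_ge:
  assumes p: "1 < p" and G: "G \<in> Lp_field p" and H: "H \<in> Lp_field p"
    and growth: "\<And>t. 0 < t \<Longrightarrow> t * c \<le> energy p (\<lambda>x. G x + t *\<^sub>R H x) - energy p G"
  shows "c \<le> p * (LINT x|M. p_flux p (ip x) (G x) (H x))"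
proof (rule LIMSEQ_le_const)
  show "(\<lambda>n. p * (LINT x|M. p_flux p (ip x) (G x + (1 / real (Suc n)) *\<^sub>R H x) (H x)))
      \<longlonglongrightarrow> p * (LINT x|M. p_flux p (ip x) (G x) (H x))"
    by (intro tendsto_intros flux_integral_continuous p G H)
  have "c \<le> p * (LINT x|M. p_flux p (ip x) (G x + t *\<^sub>R H x) (H x))" if t: "0 < t" for t
  proof -
    let ?Gt = "\<lambda>x. G x + t *\<^sub>R H x"
    have Gt: "?Gt \<in> Lp_field p" using p G H by (intro Lp_field_add Lp_field_scaleR) auto
    have "p * (LINT x|M. p_flux p (ip x) (?Gt x) ((- t) *\<^sub>R H x)) \<le> energy p G - energy p ?Gt"
      using energy_tangent[OF p Gt Lp_field_scaleR[OF H, of "- t"]] by simp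
    then have "energy p ?Gt - energy p G \<le> t * (p * (LINT x|M. p_flux p (ip x) (?Gt x) (H x)))"
      unfolding p_flux_integral_scaleR[OF Lp_fieldD(1)[OF Gt] Lp_fieldD(1)[OF H]]
      by (simp add: algebra_simps)
    with growth[OF t] have "t * c \<le> t * (p * (LINT x|M. p_flux p (ip x) (?Gt x) (H x)))" by simp
    then show ?thesis using t by simp
  qed
  then show "\<exists>N. \<forall>n\<ge>N. c \<le> p * (LINT x|M. p_flux p (ip x) (G x + (1 / real (Suc n)) *\<^sub>R H x) (H x))"
    by auto
qed

text \<open>A line of slope \<open>c\<close> touches the convex function \<open>t \<mapsto> energy p (G + t H)\<close> from below at
  \<open>t = 0\<close> exactly when \<open>c\<close> is its derivative there. One inequality comes from \<open>t > 0\<close>, the other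
  from the same argument for \<open>- H\<close> and \<open>- c\<close>.\<close>

lemma energy_first_variation_iff:
  assumes p: "1 < p" and G: "G \<in> Lp_field p" and H: "H \<in> Lp_field p"
  shows "(\<forall>t. t * c \<le> energy p (\<lambda>x. G x + t *\<^sub>R H x) - energy p G)
    \<longleftrightarrow> p * (LINT x|M. p_flux p (ip x) (G x) (H x)) = c"
proof
  note flux_scaleR = p_flux_integral_scaleR[OF Lp_fieldD(1)[OF G] Lp_fieldD(1)[OF H]]
  {
    assume growth: "\<forall>t. t * c \<le> energy p (\<lambda>x. G x + t *\<^sub>R H x) - energy p G"
    have "c \<le> p * (LINT x|M. p_flux p (ip x) (G x) (H x))"
      using growth by (intro energy_first_variation_ge p G H) auto
    moreover have "- c \<le> p * (LINT x|M. p_flux p (ip x) (G x) ((- 1) *\<^sub>R H x))"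
    proof (intro energy_first_variation_ge p G Lp_field_scaleR H)
      fix t :: real
      show "t * - c \<le> energy p (\<lambda>x. G x + t *\<^sub>R (- 1) *\<^sub>R H x) - energy p G"
        using growth[rule_format, of "- t"] by simp
    qed
    ultimately show "p * (LINT x|M. p_flux p (ip x) (G x) (H x)) = c"
      unfolding flux_scaleR by simp
  }
  assume "p * (LINT x|M. p_flux p (ip x) (G x) (H x)) = c"
  then have "t * c = p * (LINT x|M. p_flux p (ip x) (G x) (t *\<^sub>R H x))" for t
    unfolding flux_scaleR by simp
  then show "\<forall>t. t * c \<le> energy p (\<lambda>x. G x + t *\<^sub>R H x) - energy p G"
    using energy_tangent[OF p G Lp_field_scaleR[OF H]] by simp
qed

end

section \<open>Linearity of Newtonian spaces\<close>

text \<open>For nonmeasurable functions the integral is a supremum over simple functions from below, and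
  it remains superadditive. For upper gradients \<open>h\<close> of \<open>u\<close> and \<open>k\<close> of \<open>v\<close> this is the inequality
  that bounds the increments of \<open>s u + t v\<close>, \<open>|s| \<integral>h ds + |t| \<integral>k ds \<le> \<integral>(|s| h + |t| k) ds\<close>, and
  it is available without a discussion of measurability along curves.\<close>

lemma nn_integral_superadditive:
  fixes f g :: "'a \<Rightarrow> ennreal"
  shows "a * nn_integral M f + b * nn_integral M g \<le> (\<integral>\<^sup>+x. a * f x + b * g x \<partial>M)"
proof -
  let ?S = "\<lambda>f. {s. simple_function M s \<and> s \<le> f}"
  \<comment> \<open>Combinations of simple minorants are simple minorants of the combination.\<close>
  have simple: "a * integral\<^sup>S M s + b * integral\<^sup>S M t \<le> (\<integral>\<^sup>+x. a * f x + b * g x \<partial>M)"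
    if s: "s \<in> ?S f" and t: "t \<in> ?S g" for s t
  proof -
    have [measurable]: "s \<in> borel_measurable M" "t \<in> borel_measurable M"
      using s t by (auto intro: borel_measurable_simple_function)
    have "a * integral\<^sup>S M s + b * integral\<^sup>S M t = (\<integral>\<^sup>+x. a * s x + b * t x \<partial>M)"
      using s t by (simp add: nn_integral_add nn_integral_cmult nn_integral_eq_simple_integral)
    also have "\<dots> \<le> (\<integral>\<^sup>+x. a * f x + b * g x \<partial>M)"
      using s t by (intro nn_integral_mono add_mono mult_left_mono) (auto simp: le_fun_def)
    finally show ?thesis .
  qed
  have ne: "?S h \<noteq> {}" for h :: "'a \<Rightarrow> ennreal"
    by (auto intro!: exI[of _ "\<lambda>_. 0"] simp: le_fun_def)
  have "a * nn_integral M f + b * nn_integral M g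
      = (SUP s\<in>?S f. SUP t\<in>?S g. a * integral\<^sup>S M s + b * integral\<^sup>S M t)"
    unfolding nn_integral_def SUP_mult_left_ennreal
    by (subst ennreal_SUP_add_left[OF ne, symmetric], subst ennreal_SUP_add_right[OF ne]) simp
  also have "\<dots> \<le> (\<integral>\<^sup>+x. a * f x + b * g x \<partial>M)"
    using simple by (intro SUP_least) auto
  finally show ?thesis .
qed

lemma line_integral_superadditive:
  "a * line_integral c h + b * line_integral c k \<le> line_integral c (\<lambda>x. a * h x + b * k x)"
proof (cases c)
  case (fields s t \<gamma>)
  show ?thesis
    unfolding line_integral_def fields prod.case
    by (rule order.trans[OF nn_integral_superadditive]) (simp add: distrib_right mult.assoc)
qed

lemma line_integral_mono: "(\<And>x. h x \<le> k x) \<Longrightarrow> line_integral c h \<le> line_integral c k"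
  unfolding line_integral_def by (auto split: prod.split intro!: nn_integral_mono mult_right_mono)

lemma epowr_mono: "0 \<le> q \<Longrightarrow> x \<le> y \<Longrightarrow> epowr x q \<le> epowr y q"
proof -
  assume q: "0 \<le> q" and xy: "x \<le> y"
  show ?thesis
  proof (cases "y = \<infinity>")
    case False
    then have "enn2real x \<le> enn2real y" "x \<noteq> \<infinity>"
      using xy by (auto simp: enn2real_mono less_top top_unique)
    then show ?thesis using q False by (simp add: epowr_def ennreal_leI powr_mono2)
  qed (simp add: epowr_def)
qed

text \<open>For \<open>c = 0\<close> and \<open>x = \<infinity>\<close> both sides are \<open>0\<close>, by the convention \<open>0 \<cdot> \<infinity> = 0\<close>.\<close>

lemma epowr_cmult:
  assumes "0 \<le> c" "0 < q"
  shows "epowr (ennreal c * x) q = ennreal (c powr q) * epowr x q"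
proof (cases x)
  case (real r)
  then show ?thesis
    using assms by (simp add: epowr_def ennreal_mult[symmetric] powr_mult ennreal_mult_eq_top_iff)
next
  case top
  then show ?thesis using assms by (cases "c = 0") (simp_all add: epowr_def ennreal_mult_top)
qed

lemma epowr_add_le:
  assumes "0 < q"
  shows "epowr (x + y) q \<le> ennreal (2 powr q) * (epowr x q + epowr y q)"
proof (cases "x = \<infinity> \<or> y = \<infinity>")
  case True
  then have "epowr x q + epowr y q = \<infinity>" by (auto simp: epowr_def)
  then have "ennreal (2 powr q) * (epowr x q + epowr y q) = \<infinity>" by (simp only:) (simp add: ennreal_mult_top)
  then show ?thesis by simp
next
  case False
  then obtain r s where "x = ennreal r" "0 \<le> r" "y = ennreal s" "0 \<le> s"
    by (metis ennreal_cases infinity_ennreal_def)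
  then show ?thesis
    using powr_add_le[of q r s] assms
    by (simp add: epowr_def flip: ennreal_plus ennreal_mult)
qed

lemma epowr_measurable [measurable]: "(\<lambda>x. epowr x q) \<in> borel_measurable borel"
  unfolding epowr_def by measurable

lemma borel_on_measurable:
  assumes "sets (restrict_space borel (space M)) \<subseteq> sets M" "h \<in> borel_on (space M)"
  shows "h \<in> borel_measurable M"
proof (rule measurableI)
  fix S :: "ennreal set" assume "S \<in> sets borel"
  then have "h -` S \<inter> space (restrict_space borel (space M)) \<in> sets (restrict_space borel (space M))"
    using assms(2) unfolding borel_on_def by (intro measurable_sets)
  then show "h -` S \<inter> space M \<in> sets M" using assms(1) by (auto simp: space_restrict_space)
qed simp

lemma borel_on_subset:
  assumes "S \<subseteq> T" "h \<in> borel_on T"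
  shows "h \<in> borel_on S"
proof -
  have "h \<in> borel_measurable (restrict_space (restrict_space borel T) S)"
    using assms(2) by (simp add: borel_on_def measurable_restrict_space1)
  moreover have "sets (restrict_space (restrict_space borel T) S) = sets (restrict_space borel S)"
    using assms(1) by (auto simp: sets_restrict_space)
  ultimately show ?thesis unfolding borel_on_def by (simp cong: measurable_cong_sets)
qed

text \<open>If \<open>\<rho>\<close> is admissible for \<open>\<Gamma>\<close> and \<open>\<sigma>\<close> for \<open>\<Delta>\<close>, then \<open>max \<rho> \<sigma>\<close> is admissible for the
  union, and its \<open>p\<close>-th power is at most the sum of the two \<open>p\<close>-th powers.\<close>

lemma modulus_null_Un:
  assumes borel: "sets (restrict_space borel (space M)) \<subseteq> sets M"
    and "modulus p M \<Gamma> = 0" "modulus p M \<Delta> = 0"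
  shows "modulus p M (\<Gamma> \<union> \<Delta>) = 0"
proof -
  have small: "\<exists>\<rho>\<in>borel_on (space M). (\<forall>c\<in>\<Gamma>. 1 \<le> line_integral c \<rho>) \<and> (\<integral>\<^sup>+x. epowr (\<rho> x) p \<partial>M) < e"
    if "modulus p M \<Gamma> = 0" "0 < e" for \<Gamma> and e :: ennreal
  proof -
    have "modulus p M \<Gamma> < e" using that by simp
    then show ?thesis unfolding modulus_def INF_less_iff by blast
  qed
  have "modulus p M (\<Gamma> \<union> \<Delta>) \<le> 0 + ennreal e" if e: "0 < e" for e
  proof -
    have half: "0 < ennreal (e / 2)" using e by simp
    obtain \<rho> where \<rho>: "\<rho> \<in> borel_on (space M)" "\<forall>c\<in>\<Gamma>. 1 \<le> line_integral c \<rho>"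
      "(\<integral>\<^sup>+x. epowr (\<rho> x) p \<partial>M) < ennreal (e / 2)"
      using small[OF assms(2) half] by blast
    obtain \<sigma> where \<sigma>: "\<sigma> \<in> borel_on (space M)" "\<forall>c\<in>\<Delta>. 1 \<le> line_integral c \<sigma>"
      "(\<integral>\<^sup>+x. epowr (\<sigma> x) p \<partial>M) < ennreal (e / 2)"
      using small[OF assms(3) half] by blast
    note [measurable] = borel_on_measurable[OF borel \<rho>(1)] borel_on_measurable[OF borel \<sigma>(1)]
    let ?m = "\<lambda>x. max (\<rho> x) (\<sigma> x)"
    have "?m \<in> borel_on (space M)" using \<rho>(1) \<sigma>(1) by (simp add: borel_on_def)
    moreover have "1 \<le> line_integral c ?m" if "c \<in> \<Gamma> \<union> \<Delta>" for c
      using that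
    proof
      assume "c \<in> \<Gamma>"
      with \<rho>(2) have "1 \<le> line_integral c \<rho>" by (rule bspec)
      also have "\<dots> \<le> line_integral c ?m" by (rule line_integral_mono) simp
      finally show ?thesis .
    next
      assume "c \<in> \<Delta>"
      with \<sigma>(2) have "1 \<le> line_integral c \<sigma>" by (rule bspec)
      also have "\<dots> \<le> line_integral c ?m" by (rule line_integral_mono) simp
      finally show ?thesis .
    qed
    ultimately have "modulus p M (\<Gamma> \<union> \<Delta>) \<le> (\<integral>\<^sup>+x. epowr (?m x) p \<partial>M)"
      unfolding modulus_def by (intro INF_lower CollectI conjI ballI)
    also have "\<dots> \<le> (\<integral>\<^sup>+x. epowr (\<rho> x) p + epowr (\<sigma> x) p \<partial>M)"
      by (intro nn_integral_mono) (auto simp: max_def)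
    also have "\<dots> = (\<integral>\<^sup>+x. epowr (\<rho> x) p \<partial>M) + (\<integral>\<^sup>+x. epowr (\<sigma> x) p \<partial>M)"
      by (intro nn_integral_add) measurable
    also have "\<dots> \<le> ennreal (e / 2) + ennreal (e / 2)"
      using \<rho>(3) \<sigma>(3) by (intro add_mono) auto
    also have "\<dots> = 0 + ennreal e" using e by (simp flip: ennreal_plus)
    finally show ?thesis .
  qed
  then have "modulus p M (\<Gamma> \<union> \<Delta>) \<le> 0" by (rule ennreal_le_epsilon)
  then show ?thesis by simp
qed

text \<open>Every density admissible for the larger family on the larger space stays admissible after restriction.\<close>

lemma modulus_restrict_space_le:
  assumes "\<Omega> \<in> sets M" "\<Delta> \<subseteq> \<Gamma>"
  shows "modulus p (restrict_space M \<Omega>) \<Delta> \<le> modulus p M \<Gamma>"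
  unfolding modulus_def
proof (rule INF_mono)
  have sub: "\<Omega> \<subseteq> space M" using assms by (simp add: sets.sets_into_space)
  fix \<rho> assume \<rho>: "\<rho> \<in> {\<rho> \<in> borel_on (space M). \<forall>c\<in>\<Gamma>. 1 \<le> line_integral c \<rho>}"
  have "(\<integral>\<^sup>+x. epowr (\<rho> x) p \<partial>restrict_space M \<Omega>) \<le> (\<integral>\<^sup>+x. epowr (\<rho> x) p \<partial>M)"
    using assms by (subst nn_integral_restrict_space) (auto intro!: nn_integral_mono split: split_indicator)
  moreover have "\<rho> \<in> borel_on (space (restrict_space M \<Omega>))"
    using \<rho> sub borel_on_subset[of \<Omega> "space M" \<rho>] by (simp add: space_restrict_space Int_absorb2)
  ultimately show "\<exists>\<sigma>\<in>{\<rho> \<in> borel_on (space (restrict_space M \<Omega>)). \<forall>c\<in>\<Delta>. 1 \<le> line_integral c \<rho>}.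
      (\<integral>\<^sup>+x. epowr (\<sigma> x) p \<partial>restrict_space M \<Omega>) \<le> (\<integral>\<^sup>+x. epowr (\<rho> x) p \<partial>M)"
    using \<rho> assms(2) by (intro bexI[of _ \<rho>]) auto
qed

text \<open>Off the union of the two exceptional families the triangle inequality and superadditivity of the
  line integral give the upper gradient inequality for the combination.\<close>

lemma weak_ug_linear:
  assumes borel: "sets (restrict_space borel (space M)) \<subseteq> sets M"
    and h: "weak_ug p M u h" and k: "weak_ug p M v k"
  shows "weak_ug p M (\<lambda>x. s * u x + t * v x) (\<lambda>x. ennreal \<bar>s\<bar> * h x + ennreal \<bar>t\<bar> * k x)"
proof -
  let ?w = "\<lambda>x. s * u x + t * v x" and ?l = "\<lambda>x. ennreal \<bar>s\<bar> * h x + ennreal \<bar>t\<bar> * k x"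
  obtain \<Gamma> where \<Gamma>: "\<Gamma> \<subseteq> curves (space M)" "modulus p M \<Gamma> = 0"
    "\<forall>c\<in>curves (space M) - \<Gamma>. ug_along u h c"
    using h by (auto simp: weak_ug_def)
  obtain \<Delta> where \<Delta>: "\<Delta> \<subseteq> curves (space M)" "modulus p M \<Delta> = 0"
    "\<forall>c\<in>curves (space M) - \<Delta>. ug_along v k c"
    using k by (auto simp: weak_ug_def)
  have along: "ug_along ?w ?l c" if "ug_along u h c" "ug_along v k c" for c
  proof (cases c)
    case (fields a b \<gamma>)
    have "\<bar>?w (\<gamma> a) - ?w (\<gamma> b)\<bar> = \<bar>s * (u (\<gamma> a) - u (\<gamma> b)) + t * (v (\<gamma> a) - v (\<gamma> b))\<bar>"
      by (simp add: algebra_simps)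
    also have "\<dots> \<le> \<bar>s\<bar> * \<bar>u (\<gamma> a) - u (\<gamma> b)\<bar> + \<bar>t\<bar> * \<bar>v (\<gamma> a) - v (\<gamma> b)\<bar>"
      by (metis abs_mult abs_triangle_ineq)
    finally have "ennreal \<bar>?w (\<gamma> a) - ?w (\<gamma> b)\<bar>
        \<le> ennreal (\<bar>s\<bar> * \<bar>u (\<gamma> a) - u (\<gamma> b)\<bar> + \<bar>t\<bar> * \<bar>v (\<gamma> a) - v (\<gamma> b)\<bar>)"
      by (rule ennreal_leI)
    also have "\<dots> = ennreal \<bar>s\<bar> * ennreal \<bar>u (\<gamma> a) - u (\<gamma> b)\<bar> + ennreal \<bar>t\<bar> * ennreal \<bar>v (\<gamma> a) - v (\<gamma> b)\<bar>"
      by (simp add: ennreal_plus ennreal_mult)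
    also have "\<dots> \<le> ennreal \<bar>s\<bar> * line_integral c h + ennreal \<bar>t\<bar> * line_integral c k"
      using that fields by (intro add_mono mult_left_mono) (auto simp: ug_along_def)
    also have "\<dots> \<le> line_integral c ?l" by (rule line_integral_superadditive)
    finally show ?thesis by (simp add: ug_along_def fields)
  qed
  have l: "?l \<in> borel_on (space M)"
  proof -
    have [measurable]: "h \<in> borel_measurable (restrict_space borel (space M))"
      "k \<in> borel_measurable (restrict_space borel (space M))"
      using h k by (auto simp: weak_ug_def borel_on_def)
    show ?thesis unfolding borel_on_def by measurable
  qed
  show ?thesis
    unfolding weak_ug_def
  proof (intro conjI exI[of _ "\<Gamma> \<union> \<Delta>"] ballI)
    show "ug_along ?w ?l c" if "c \<in> curves (space M) - (\<Gamma> \<union> \<Delta>)" for c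
      using that \<Gamma>(3) \<Delta>(3) by (intro along) blast+
    show "\<Gamma> \<union> \<Delta> \<subseteq> curves (space M)" using \<Gamma>(1) \<Delta>(1) by blast
    show "?l \<in> borel_on (space M)" by (rule l)
    show "modulus p M (\<Gamma> \<union> \<Delta>) = 0" by (rule modulus_null_Un[OF borel \<Gamma>(2) \<Delta>(2)])
  qed
qed

lemma Lp_fun_linear:
  assumes p: "0 < p" and u: "u \<in> Lp_fun p M" and v: "v \<in> Lp_fun p M"
  shows "(\<lambda>x. s * u x + t * v x) \<in> Lp_fun p M"
proof -
  have [measurable]: "u \<in> borel_measurable M" "v \<in> borel_measurable M"
    and int: "integrable M (\<lambda>x. \<bar>u x\<bar> powr p)" "integrable M (\<lambda>x. \<bar>v x\<bar> powr p)"
    using u v by (auto simp: Lp_fun_def)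
  have "integrable M (\<lambda>x. \<bar>s * u x + t * v x\<bar> powr p)"
  proof (rule Bochner_Integration.integrable_bound)
    show "integrable M (\<lambda>x. 2 powr p * (\<bar>s\<bar> powr p * \<bar>u x\<bar> powr p + \<bar>t\<bar> powr p * \<bar>v x\<bar> powr p))"
      using int by simp
    have "\<bar>s * u x + t * v x\<bar> powr p
        \<le> 2 powr p * (\<bar>s\<bar> powr p * \<bar>u x\<bar> powr p + \<bar>t\<bar> powr p * \<bar>v x\<bar> powr p)" for x
    proof -
      have "\<bar>s * u x + t * v x\<bar> powr p \<le> (\<bar>s * u x\<bar> + \<bar>t * v x\<bar>) powr p"
        using p by (intro powr_mono2) auto
      also have "\<dots> \<le> 2 powr p * (\<bar>s * u x\<bar> powr p + \<bar>t * v x\<bar> powr p)"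
        using p by (intro powr_add_le) auto
      finally show ?thesis by (simp add: abs_mult powr_mult)
    qed
    then show "AE x in M. norm (\<bar>s * u x + t * v x\<bar> powr p)
        \<le> norm (2 powr p * (\<bar>s\<bar> powr p * \<bar>u x\<bar> powr p + \<bar>t\<bar> powr p * \<bar>v x\<bar> powr p))"
      by (auto intro!: AE_I2 order.trans[OF _ abs_ge_self])
  qed measurable
  then show ?thesis by (simp add: Lp_fun_def)
qed

lemma newtonianI:
  "u \<in> Lp_fun p M \<Longrightarrow> weak_ug p M u h \<Longrightarrow> (\<integral>\<^sup>+x. epowr (h x) p \<partial>M) < \<infinity> \<Longrightarrow> u \<in> newtonian p M"
  unfolding newtonian_def by blast

lemma newtonian_linear:
  assumes borel: "sets (restrict_space borel (space M)) \<subseteq> sets M" and p: "0 < p"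
    and u: "u \<in> newtonian p M" and v: "v \<in> newtonian p M"
  shows "(\<lambda>x. s * u x + t * v x) \<in> newtonian p M"
proof -
  obtain h where h: "weak_ug p M u h" "(\<integral>\<^sup>+x. epowr (h x) p \<partial>M) < \<infinity>"
    using u by (auto simp: newtonian_def)
  obtain k where k: "weak_ug p M v k" "(\<integral>\<^sup>+x. epowr (k x) p \<partial>M) < \<infinity>"
    using v by (auto simp: newtonian_def)
  have [measurable]: "h \<in> borel_measurable M" "k \<in> borel_measurable M"
    using h k borel_on_measurable[OF borel] by (auto simp: weak_ug_def)
  have "(\<integral>\<^sup>+x. epowr (ennreal \<bar>s\<bar> * h x + ennreal \<bar>t\<bar> * k x) p \<partial>M)
      \<le> (\<integral>\<^sup>+x. ennreal (2 powr p) * (ennreal (\<bar>s\<bar> powr p) * epowr (h x) p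
          + ennreal (\<bar>t\<bar> powr p) * epowr (k x) p) \<partial>M)"
    using epowr_add_le[OF p] p by (intro nn_integral_mono) (simp flip: epowr_cmult)
  also have "\<dots> = ennreal (2 powr p) * (ennreal (\<bar>s\<bar> powr p) * (\<integral>\<^sup>+x. epowr (h x) p \<partial>M)
      + ennreal (\<bar>t\<bar> powr p) * (\<integral>\<^sup>+x. epowr (k x) p \<partial>M))"
    by (simp add: nn_integral_cmult nn_integral_add)
  also have "\<dots> < \<infinity>" using h(2) k(2) by (simp add: ennreal_mult_less_top less_top)
  finally have "(\<integral>\<^sup>+x. epowr (ennreal \<bar>s\<bar> * h x + ennreal \<bar>t\<bar> * k x) p \<partial>M) < \<infinity>" .
  moreover have "(\<lambda>x. s * u x + t * v x) \<in> Lp_fun p M"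
    using u v p by (intro Lp_fun_linear) (auto simp: newtonian_def)
  ultimately show ?thesis
    by (intro newtonianI[OF _ weak_ug_linear[OF borel h(1) k(1)]])
qed

lemma newtonian_zero_linear:
  assumes borel: "sets (restrict_space borel (space \<mu>)) \<subseteq> sets \<mu>" and p: "0 < p"
    and "\<phi> \<in> newtonian_zero p \<mu> \<Omega>" "\<psi> \<in> newtonian_zero p \<mu> \<Omega>"
  shows "(\<lambda>x. s * \<phi> x + t * \<psi> x) \<in> newtonian_zero p \<mu> \<Omega>"
proof -
  obtain w where w: "w \<in> newtonian p \<mu>" "\<forall>x. x \<notin> \<Omega> \<longrightarrow> w x = 0" "\<forall>x\<in>\<Omega>. \<phi> x = w x"
    using assms(3) by (auto simp: newtonian_zero_def)
  obtain z where z: "z \<in> newtonian p \<mu>" "\<forall>x. x \<notin> \<Omega> \<longrightarrow> z x = 0" "\<forall>x\<in>\<Omega>. \<psi> x = z x"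
    using assms(4) by (auto simp: newtonian_zero_def)
  show ?thesis
    unfolding newtonian_zero_def
    using w(2,3) z(2,3) by (intro CollectI bexI[OF _ newtonian_linear[OF borel p w(1) z(1)]]) auto
qed

lemma mem_curves_iff:
  "(a, b, \<gamma>) \<in> curves S \<longleftrightarrow> a < b \<and> continuous_on {a..b} \<gamma> \<and> \<gamma> ` {a..b} \<subseteq> S \<and>
     curve_length a b \<gamma> < \<infinity> \<and> (\<exists>s\<in>{a..b}. \<exists>t\<in>{a..b}. \<gamma> s \<noteq> \<gamma> t)"
  unfolding curves_def mem_Collect_eq prod.case ..

lemma curves_mono:
  assumes "S \<subseteq> T"
  shows "curves S \<subseteq> curves T"
proof
  fix c assume c: "c \<in> curves S"
  obtain a b \<gamma> where abc: "c = (a, b, \<gamma>)" by (rule prod_cases3)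
  show "c \<in> curves T"
    using c assms unfolding abc mem_curves_iff by (elim conjE) (intro conjI order.trans[OF _ assms])
qed

text \<open>The restriction to \<open>\<Omega>\<close> of a Newtonian function on the whole space: curves in \<open>\<Omega>\<close> are curves in
  the space, and the exceptional ones among them still form a family of modulus zero. In particular
  \<open>N\<^sub>0\<^sup>1\<^sup>,\<^sup>p(\<Omega>)\<close> is contained in \<open>N\<^sup>1\<^sup>,\<^sup>p(\<Omega>)\<close>.\<close>

lemma newtonian_restrict_space:
  assumes \<Omega>: "\<Omega> \<in> sets \<mu>" and w: "w \<in> newtonian p \<mu>" and eq: "\<And>x. x \<in> \<Omega> \<Longrightarrow> \<phi> x = w x"
  shows "\<phi> \<in> newtonian p (restrict_space \<mu> \<Omega>)"
proof -
  let ?M = "restrict_space \<mu> \<Omega>"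
  have sub: "\<Omega> \<subseteq> space \<mu>" using \<Omega> by (rule sets.sets_into_space)
  then have sp: "space ?M = \<Omega>" by (simp add: space_restrict_space Int_absorb2)
  obtain h where h: "weak_ug p \<mu> w h" "(\<integral>\<^sup>+x. epowr (h x) p \<partial>\<mu>) < \<infinity>"
    using w by (auto simp: newtonian_def)
  obtain \<Gamma> where \<Gamma>: "\<Gamma> \<subseteq> curves (space \<mu>)" "modulus p \<mu> \<Gamma> = 0"
    "\<forall>c\<in>curves (space \<mu>) - \<Gamma>. ug_along w h c"
    using h(1) by (auto simp: weak_ug_def)
  have "weak_ug p ?M \<phi> h"
    unfolding weak_ug_def sp
  proof (intro conjI exI[of _ "\<Gamma> \<inter> curves \<Omega>"])
    show "h \<in> borel_on \<Omega>" using h(1) borel_on_subset[OF sub] by (auto simp: weak_ug_def)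
    show "modulus p ?M (\<Gamma> \<inter> curves \<Omega>) = 0"
      using modulus_restrict_space_le[OF \<Omega>, of "\<Gamma> \<inter> curves \<Omega>" \<Gamma> p] \<Gamma>(2) by simp
    show "\<forall>c\<in>curves \<Omega> - \<Gamma> \<inter> curves \<Omega>. ug_along \<phi> h c"
    proof
      fix c assume c: "c \<in> curves \<Omega> - \<Gamma> \<inter> curves \<Omega>"
      obtain a b \<gamma> where abc: "c = (a, b, \<gamma>)" by (cases c)
      have "ug_along w h c" using c \<Gamma>(3) curves_mono[OF sub] by blast
      moreover have "(a, b, \<gamma>) \<in> curves \<Omega>" using c unfolding abc by blast
      then have "\<gamma> a \<in> \<Omega>" "\<gamma> b \<in> \<Omega>" unfolding mem_curves_iff by auto
      ultimately show "ug_along \<phi> h c" by (simp add: ug_along_def abc eq)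
    qed
  qed auto
  moreover have "(\<integral>\<^sup>+x. epowr (h x) p \<partial>?M) < \<infinity>"
  proof (rule order.strict_trans1[OF _ h(2)])
    show "(\<integral>\<^sup>+x. epowr (h x) p \<partial>?M) \<le> (\<integral>\<^sup>+x. epowr (h x) p \<partial>\<mu>)"
      using \<Omega> by (subst nn_integral_restrict_space) (auto intro!: nn_integral_mono split: split_indicator)
  qed
  moreover have "\<phi> \<in> Lp_fun p ?M"
  proof -
    have w': "w \<in> borel_measurable \<mu>" "integrable \<mu> (\<lambda>x. \<bar>w x\<bar> powr p)"
      using w by (auto simp: newtonian_def Lp_fun_def)
    have "\<phi> \<in> borel_measurable ?M \<longleftrightarrow> w \<in> borel_measurable ?M"
      by (rule measurable_cong) (simp add: sp eq)
    moreover have "integrable ?M (\<lambda>x. \<bar>\<phi> x\<bar> powr p) \<longleftrightarrow> integrable ?M (\<lambda>x. \<bar>w x\<bar> powr p)"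
      by (rule Bochner_Integration.integrable_cong) (simp_all add: sp eq)
    moreover have "integrable ?M (\<lambda>x. \<bar>w x\<bar> powr p)"
      using \<Omega> integrable_mult_indicator[OF \<Omega> w'(2)] by (subst integrable_restrict_space) auto
    ultimately show ?thesis
      using w'(1) by (simp add: Lp_fun_def measurable_restrict_space1)
  qed
  ultimately show ?thesis by (intro newtonianI[where h = h])
qed

section \<open>Minimizers and weak solutions\<close>

lemma Lp_fun_mult_integrable:
  assumes p: "1 < p" and f: "f \<in> Lp_fun (p / (p - 1)) M" and v: "v \<in> Lp_fun p M"
  shows "integrable M (\<lambda>x. f x * v x)"
proof (rule Bochner_Integration.integrable_bound)
  let ?q = "p / (p - 1)"
  have [measurable]: "f \<in> borel_measurable M" "v \<in> borel_measurable M"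
    using f v by (auto simp: Lp_fun_def)
  show "(\<lambda>x. f x * v x) \<in> borel_measurable M" by measurable
  show "integrable M (\<lambda>x. \<bar>f x\<bar> powr ?q / ?q + \<bar>v x\<bar> powr p / p)"
    using f v by (simp add: Lp_fun_def)
  have "\<bar>f x\<bar> * \<bar>v x\<bar> \<le> \<bar>f x\<bar> powr ?q / ?q + \<bar>v x\<bar> powr p / p" for x
    using p by (intro Youngs_inequality) (auto simp: field_simps)
  then show "AE x in M. norm (f x * v x) \<le> norm (\<bar>f x\<bar> powr ?q / ?q + \<bar>v x\<bar> powr p / p)"
    by (intro AE_I2) (simp add: abs_mult order.trans[OF _ abs_ge_self])
qed

lemma set_lebesgue_integral_restrict_space:
  fixes f :: "'a \<Rightarrow> real"
  assumes "\<Omega> \<in> sets M"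
  shows "(LINT x:\<Omega>|M. f x) = (LINT x|restrict_space M \<Omega>. f x)"
  using assms by (simp add: set_lebesgue_integral_def integral_restrict_space)

text \<open>The comparison \<open>|\<nabla>u|\<^sub>x \<le> g\<^sub>u\<close> is what gives the gradient finite energy, since \<open>g\<^sub>u\<close> lies
  in \<open>L\<^sup>p\<close> by definition.\<close>

lemma gradient_comparison_Lp_field:
  fixes M :: "'a::metric_space measure"
  assumes "inner_product_field M ip"
    and G: "G \<in> borel_measurable M" and "gradient_comparison p M ip u G" and p: "0 < p"
  shows "G \<in> inner_product_field.Lp_field M ip p"
proof -
  interpret inner_product_field M ip by fact
  note [measurable] = G
  obtain g where g: "(\<integral>\<^sup>+x. epowr (g x) p \<partial>M) < \<infinity>"
    and le: "AE x in M. ennreal (ip_norm (ip x) (G x)) \<le> g x"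
    using assms(3) unfolding gradient_comparison_def min_weak_ug_def by (auto elim: AE_mp)
  have "(\<integral>\<^sup>+x. ennreal (ip_norm (ip x) (G x) powr p) \<partial>M) \<le> (\<integral>\<^sup>+x. epowr (g x) p \<partial>M)"
  proof (rule nn_integral_mono_AE)
    show "AE x in M. ennreal (ip_norm (ip x) (G x) powr p) \<le> epowr (g x) p"
      using le ip_inner
    proof eventually_elim
      case (elim x)
      have "ennreal (ip_norm (ip x) (G x) powr p) = epowr (ennreal (ip_norm (ip x) (G x))) p"
        using elim(2) by (simp add: epowr_def)
      also have "\<dots> \<le> epowr (g x) p" using elim(1) p by (intro epowr_mono) auto
      finally show ?case .
    qed
  qed
  then have "(\<integral>\<^sup>+x. ennreal (ip_norm (ip x) (G x) powr p) \<partial>M) < \<infinity>" using g by (rule order.strict_trans1)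
  then have "integrable M (\<lambda>x. ip_norm (ip x) (G x) powr p)"
    by (intro integrableI_nonneg) auto
  then show ?thesis using G by (simp add: Lp_field_def)
qed

text \<open>The competitors of the minimization problem are exactly the functions \<open>u + t \<phi>\<close> with
  \<open>\<phi> \<in> N\<^sub>0\<^sup>1\<^sup>,\<^sup>p(\<Omega>)\<close>, so the equivalence can be proved for one \<open>\<phi>\<close> at a time.\<close>

theorem theorem3p13:
  fixes p :: real
    and \<mu> :: "'a::complete_space measure"
    and \<Omega> :: "'a set"
    and A :: "nat set"
    and U :: "nat \<Rightarrow> 'a set"
    and I :: "nat \<Rightarrow> 'n::finite set"
    and F :: "nat \<Rightarrow> 'n \<Rightarrow> 'a \<Rightarrow> real"
    and V :: "('a \<Rightarrow> real) \<Rightarrow> nat \<Rightarrow> 'a set"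
    and D :: "('a \<Rightarrow> real) \<Rightarrow> nat \<Rightarrow> 'a \<Rightarrow> real ^ 'n"
    and ip :: "'a \<Rightarrow> real ^ 'n \<Rightarrow> real ^ 'n \<Rightarrow> real"
    and nabla nabla\<^sub>\<Omega> :: "('a \<Rightarrow> real) \<Rightarrow> 'a \<Rightarrow> real ^ 'n"
    and f u g :: "'a \<Rightarrow> real"
  assumes "1 < p"
    and "metric_measure \<mu>" and "geodesic_metric TYPE('a)" and "doubling \<mu>" and "poincare p \<mu>"
    and "\<Omega> \<noteq> {}" and "bounded \<Omega>" and "open \<Omega>" and "connected \<Omega>"
    and "0 < emeasure \<mu> (UNIV - \<Omega>)"
    and "cheeger_gradient p \<mu> A U I F V D ip nabla"
    and "cheeger_gradient_on p \<mu> \<Omega> ip nabla nabla\<^sub>\<Omega>"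
    and "f \<in> Lp_fun (p / (p - 1)) (restrict_space \<mu> \<Omega>)"
    and "u \<in> newtonian p (restrict_space \<mu> \<Omega>)" and "g \<in> newtonian p (restrict_space \<mu> \<Omega>)"
    and "(\<lambda>x. u x - g x) \<in> newtonian_zero p \<mu> \<Omega>"
  shows "(\<forall>\<phi>\<in>newtonian_zero p \<mu> \<Omega>.
            (LINT x:\<Omega>|\<mu>. ip_norm (ip x) (nabla\<^sub>\<Omega> u x) powr (p - 2) * ip x (nabla\<^sub>\<Omega> u x) (nabla\<^sub>\<Omega> \<phi> x))
              = (LINT x:\<Omega>|\<mu>. f x * \<phi> x))
         \<longleftrightarrow>
         (\<forall>v\<in>newtonian p (restrict_space \<mu> \<Omega>). (\<lambda>x. v x - g x) \<in> newtonian_zero p \<mu> \<Omega> \<longrightarrow>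
            J_C p \<mu> \<Omega> ip nabla\<^sub>\<Omega> f u \<le> J_C p \<mu> \<Omega> ip nabla\<^sub>\<Omega> f v)"
proof -
  note p = \<open>1 < p\<close>
  interpret cheeger_gradient p \<mu> A U I F V D ip nabla by fact
  interpret on: cheeger_gradient_on p \<mu> \<Omega> ip nabla nabla\<^sub>\<Omega> by fact
  let ?M = "restrict_space \<mu> \<Omega>"
  have sp: "space \<mu> = UNIV" and borel: "sets borel \<subseteq> sets \<mu>" and compl: "complete_measure \<mu>"
    using \<open>metric_measure \<mu>\<close> by (auto simp: metric_measure_def)
  have \<Omega>: "\<Omega> \<in> sets \<mu>" using \<open>open \<Omega>\<close> borel by auto
  have borel_\<mu>: "sets (restrict_space borel (space \<mu>)) \<subseteq> sets \<mu>"
    using borel by (simp add: sp sets_restrict_space)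
  have borel_M: "sets (restrict_space borel (space ?M)) \<subseteq> sets ?M"
    using borel by (auto simp: sp sets_restrict_space space_restrict_space)
  interpret fld: inner_product_field ?M ip
  proof (intro inner_product_field.intro inner_product_field_axioms.intro)
    show "complete_measure ?M" using compl \<Omega> by (rule complete_measure_restrict_space)
    show "AE x in ?M. is_inner_product (ip x)"
      using ip_inner \<Omega> by (subst AE_restrict_space_iff) (auto elim: eventually_mono)
    show "(\<lambda>x. ip x v w) \<in> borel_measurable ?M" for v w
      using ip_meas by (rule measurable_restrict_space1)
  qed
  \<comment> \<open>\<open>load v\<close> is the work of the source term; it enters the functional with the factor \<open>- p\<close>.\<close>
  define load where "load v = (LINT x|?M. f x * v x)" for v
  have J: "J_C p \<mu> \<Omega> ip nabla\<^sub>\<Omega> f v = fld.energy p (nabla\<^sub>\<Omega> v) - p * load v" for v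
    unfolding J_C_def fld.energy_def load_def set_lebesgue_integral_restrict_space[OF \<Omega>] ..
  have grad: "nabla\<^sub>\<Omega> v \<in> fld.Lp_field p" if "v \<in> newtonian p ?M" for v
    using p that by (intro gradient_comparison_Lp_field[where u = v] fld.inner_product_field_axioms on.on_meas on.on_comparison) auto
  have load_int: "integrable ?M (\<lambda>x. f x * v x)" if "v \<in> newtonian p ?M" for v
    using that by (intro Lp_fun_mult_integrable[OF p assms(13)]) (simp add: newtonian_def)
  have zero_newtonian: "\<phi> \<in> newtonian p ?M" if "\<phi> \<in> newtonian_zero p \<mu> \<Omega>" for \<phi>
    using that newtonian_restrict_space[OF \<Omega>] unfolding newtonian_zero_def by blast
  \<comment> \<open>Linearity of the gradient turns the increment of \<open>J_C\<close> along \<open>\<phi>\<close> into an increment of the energy along \<open>\<nabla>\<phi>\<close>.\<close>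
  have variation: "J_C p \<mu> \<Omega> ip nabla\<^sub>\<Omega> f (\<lambda>x. u x + t * \<phi> x) - J_C p \<mu> \<Omega> ip nabla\<^sub>\<Omega> f u
      = fld.energy p (\<lambda>x. nabla\<^sub>\<Omega> u x + t *\<^sub>R nabla\<^sub>\<Omega> \<phi> x) - fld.energy p (nabla\<^sub>\<Omega> u) - t * (p * load \<phi>)"
    if \<phi>: "\<phi> \<in> newtonian_zero p \<mu> \<Omega>" for \<phi> t
  proof -
    note u = assms(14) and \<phi>' = zero_newtonian[OF \<phi>]
    have v: "(\<lambda>x. u x + t * \<phi> x) \<in> newtonian p ?M"
      using newtonian_linear[OF borel_M _ u \<phi>', of 1 t] p by simp
    note [measurable] = on.on_meas[OF u] on.on_meas[OF \<phi>'] on.on_meas[OF v]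
    have energy_eq: "fld.energy p (nabla\<^sub>\<Omega> (\<lambda>x. u x + t * \<phi> x)) = fld.energy p (\<lambda>x. nabla\<^sub>\<Omega> u x + t *\<^sub>R nabla\<^sub>\<Omega> \<phi> x)"
      unfolding fld.energy_def
    proof (rule integral_cong_AE)
      show "AE x in ?M. ip_norm (ip x) (nabla\<^sub>\<Omega> (\<lambda>x. u x + t * \<phi> x) x) powr p
          = ip_norm (ip x) (nabla\<^sub>\<Omega> u x + t *\<^sub>R nabla\<^sub>\<Omega> \<phi> x) powr p"
        using on.on_linear[OF u \<phi>', of 1 t] by eventually_elim simp
    qed measurable
    have load_eq: "load (\<lambda>x. u x + t * \<phi> x) = load u + t * load \<phi>"
    proof -
      have "load (\<lambda>x. u x + t * \<phi> x) = (LINT x|?M. f x * u x + t * (f x * \<phi> x))"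
        unfolding load_def by (simp add: algebra_simps)
      then show ?thesis
        unfolding load_def using load_int[OF u] load_int[OF \<phi>'] by simp
    qed
    show ?thesis unfolding J energy_eq load_eq by (simp add: right_diff_distrib distrib_left mult_ac)
  qed
  have weak_iff: "(LINT x:\<Omega>|\<mu>. ip_norm (ip x) (nabla\<^sub>\<Omega> u x) powr (p - 2) * ip x (nabla\<^sub>\<Omega> u x) (nabla\<^sub>\<Omega> \<phi> x))
        = (LINT x:\<Omega>|\<mu>. f x * \<phi> x)
      \<longleftrightarrow> (\<forall>t. J_C p \<mu> \<Omega> ip nabla\<^sub>\<Omega> f u \<le> J_C p \<mu> \<Omega> ip nabla\<^sub>\<Omega> f (\<lambda>x. u x + t * \<phi> x))"
    (is "_ \<longleftrightarrow> ?min")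
    if \<phi>: "\<phi> \<in> newtonian_zero p \<mu> \<Omega>" for \<phi>
  proof -
    have "?min \<longleftrightarrow> (\<forall>t. t * (p * load \<phi>)
        \<le> fld.energy p (\<lambda>x. nabla\<^sub>\<Omega> u x + t *\<^sub>R nabla\<^sub>\<Omega> \<phi> x) - fld.energy p (nabla\<^sub>\<Omega> u))"
      (is "_ \<longleftrightarrow> (\<forall>t. _ \<le> ?increment t)")
    proof (rule iff_allI)
      show "J_C p \<mu> \<Omega> ip nabla\<^sub>\<Omega> f u \<le> J_C p \<mu> \<Omega> ip nabla\<^sub>\<Omega> f (\<lambda>x. u x + t * \<phi> x)
          \<longleftrightarrow> t * (p * load \<phi>) \<le> ?increment t" for t
        using variation[OF \<phi>, of t] by linarith
    qed
    also have "\<dots> \<longleftrightarrow> p * (LINT x|?M. p_flux p (ip x) (nabla\<^sub>\<Omega> u x) (nabla\<^sub>\<Omega> \<phi> x)) = p * load \<phi>"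
      using assms(14) zero_newtonian[OF \<phi>] by (intro fld.energy_first_variation_iff p grad)
    finally show ?thesis
      using p unfolding set_lebesgue_integral_restrict_space[OF \<Omega>] load_def p_flux_def by simp
  qed
  have admissible: "v \<in> newtonian p ?M \<and> (\<lambda>x. v x - g x) \<in> newtonian_zero p \<mu> \<Omega>
      \<longleftrightarrow> (\<exists>\<phi>\<in>newtonian_zero p \<mu> \<Omega>. \<exists>t. v = (\<lambda>x. u x + t * \<phi> x))" for v
  proof
    assume "v \<in> newtonian p ?M \<and> (\<lambda>x. v x - g x) \<in> newtonian_zero p \<mu> \<Omega>"
    then have "(\<lambda>x. v x - u x) \<in> newtonian_zero p \<mu> \<Omega>"
      using newtonian_zero_linear[OF borel_\<mu> _ _ assms(16), of "\<lambda>x. v x - g x" 1 "-1"] p by simp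
    then show "\<exists>\<phi>\<in>newtonian_zero p \<mu> \<Omega>. \<exists>t. v = (\<lambda>x. u x + t * \<phi> x)"
      \<comment> \<open>The competitor \<open>v\<close> is reached at \<open>t = 1\<close> in the direction \<open>v - u\<close>.\<close>
      by (intro bexI[of _ "\<lambda>x. v x - u x"] exI[of _ 1]) auto
  next
    assume "\<exists>\<phi>\<in>newtonian_zero p \<mu> \<Omega>. \<exists>t. v = (\<lambda>x. u x + t * \<phi> x)"
    then obtain \<phi> t where \<phi>: "\<phi> \<in> newtonian_zero p \<mu> \<Omega>" and v: "v = (\<lambda>x. u x + t * \<phi> x)" by blast
    have "v \<in> newtonian p ?M"
      using newtonian_linear[OF borel_M _ assms(14) zero_newtonian[OF \<phi>], of 1 t] p by (simp add: v)
    moreover have "(\<lambda>x. v x - g x) \<in> newtonian_zero p \<mu> \<Omega>"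
      using newtonian_zero_linear[OF borel_\<mu> _ assms(16) \<phi>, of 1 t] p by (simp add: v algebra_simps)
    ultimately show "v \<in> newtonian p ?M \<and> (\<lambda>x. v x - g x) \<in> newtonian_zero p \<mu> \<Omega>" ..
  qed
  show ?thesis
    (is "?weak \<longleftrightarrow> ?minimal")
  proof
    assume weak: ?weak
    show ?minimal
    proof (intro ballI impI)
      fix v assume "v \<in> newtonian p ?M" "(\<lambda>x. v x - g x) \<in> newtonian_zero p \<mu> \<Omega>"
      then obtain \<phi> t where \<phi>: "\<phi> \<in> newtonian_zero p \<mu> \<Omega>" and v: "v = (\<lambda>x. u x + t * \<phi> x)"
        using admissible[of v] by blast
      show "J_C p \<mu> \<Omega> ip nabla\<^sub>\<Omega> f u \<le> J_C p \<mu> \<Omega> ip nabla\<^sub>\<Omega> f v"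
        unfolding v using weak_iff[OF \<phi>] bspec[OF weak \<phi>] by blast
    qed
  next
    assume minimal: ?minimal
    show ?weak
    proof
      fix \<phi> assume \<phi>: "\<phi> \<in> newtonian_zero p \<mu> \<Omega>"
      have "J_C p \<mu> \<Omega> ip nabla\<^sub>\<Omega> f u \<le> J_C p \<mu> \<Omega> ip nabla\<^sub>\<Omega> f (\<lambda>x. u x + t * \<phi> x)" for t
      proof -
        have v: "(\<lambda>x. u x + t * \<phi> x) \<in> newtonian p ?M
            \<and> (\<lambda>x. (u x + t * \<phi> x) - g x) \<in> newtonian_zero p \<mu> \<Omega>"
          using \<phi> by (intro iffD2[OF admissible] bexI[of _ \<phi>] exI[of _ t] refl)
        show ?thesis by (rule minimal[THEN bspec, THEN mp, OF conjunct1[OF v] conjunct2[OF v]])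
      qed
      then show "(LINT x:\<Omega>|\<mu>. ip_norm (ip x) (nabla\<^sub>\<Omega> u x) powr (p - 2) * ip x (nabla\<^sub>\<Omega> u x) (nabla\<^sub>\<Omega> \<phi> x))
          = (LINT x:\<Omega>|\<mu>. f x * \<phi> x)"
        using weak_iff[OF \<phi>] by blast
    qed
  qed
qed

end
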